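(* Let $U$ be any consistent computably enumerable theory extending $\mathsf{EA}$. Then there exists a $\Pi^0_1$-formula $\rho(x)$ such that: (Independence) for every sentence $\phi$, if $U+\phi$ is consistent, then both $U+\phi+\rho(\ulcorner\phi\urcorner)$ and $U+\phi+\neg\rho(\ulcorner\phi\urcorner)$ are consistent; (Consistent Extensionality) for all sentences $\phi,\psi$, if $U+\phi$ is consistent and $U\vdash\phi\leftrightarrow\psi$, then $\mathsf{EA}\vdash\rho(\ulcorner\phi\urcorner)\leftrightarrow\rho(\ulcorner\psi\urcorner)$.
   Context: $\mathsf{EA}$ is Elementary Arithmetic, $\mathrm{I}\Delta_0+\mathsf{Exp}$. $\ulcorner\phi\urcorner$ denotes the numeral of the Gödel number of $\phi$. *)

theory Defs
  imports Main "HOL-Library.Nat_Bijection"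
begin

section \<open>Syntax of first-order arithmetic (language 0, S, +, *, 2^x, =, \<le>), de Bruijn indices\<close>

datatype trm = Var nat | Zr | Sc trm | Pl trm trm | Tm trm trm | Ex2 trm

datatype fm = Fls | Eqt trm trm | Leq trm trm | Imp fm fm | Forall fm

definition Neg :: "fm \<Rightarrow> fm" where "Neg A = Imp A Fls"
definition Conj :: "fm \<Rightarrow> fm \<Rightarrow> fm" where "Conj A B = Neg (Imp A (Neg B))"
definition Disj :: "fm \<Rightarrow> fm \<Rightarrow> fm" where "Disj A B = Imp (Neg A) B"
definition Iff :: "fm \<Rightarrow> fm \<Rightarrow> fm" where "Iff A B = Conj (Imp A B) (Imp B A)"
definition Exists :: "fm \<Rightarrow> fm" where "Exists A = Neg (Forall (Neg A))"

fun liftT :: "nat \<Rightarrow> trm \<Rightarrow> trm" where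
  "liftT k (Var i) = Var (if i < k then i else Suc i)"
| "liftT k Zr = Zr"
| "liftT k (Sc t) = Sc (liftT k t)"
| "liftT k (Pl t s) = Pl (liftT k t) (liftT k s)"
| "liftT k (Tm t s) = Tm (liftT k t) (liftT k s)"
| "liftT k (Ex2 t) = Ex2 (liftT k t)"

fun liftF :: "nat \<Rightarrow> fm \<Rightarrow> fm" where
  "liftF k Fls = Fls"
| "liftF k (Eqt t s) = Eqt (liftT k t) (liftT k s)"
| "liftF k (Leq t s) = Leq (liftT k t) (liftT k s)"
| "liftF k (Imp A B) = Imp (liftF k A) (liftF k B)"
| "liftF k (Forall A) = Forall (liftF (Suc k) A)"

fun substT :: "nat \<Rightarrow> trm \<Rightarrow> trm \<Rightarrow> trm" where
  "substT k u (Var i) = (if i < k then Var i else if i = k then u else Var (i - 1))"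
| "substT k u Zr = Zr"
| "substT k u (Sc t) = Sc (substT k u t)"
| "substT k u (Pl t s) = Pl (substT k u t) (substT k u s)"
| "substT k u (Tm t s) = Tm (substT k u t) (substT k u s)"
| "substT k u (Ex2 t) = Ex2 (substT k u t)"

fun substF :: "nat \<Rightarrow> trm \<Rightarrow> fm \<Rightarrow> fm" where
  "substF k u Fls = Fls"
| "substF k u (Eqt t s) = Eqt (substT k u t) (substT k u s)"
| "substF k u (Leq t s) = Leq (substT k u t) (substT k u s)"
| "substF k u (Imp A B) = Imp (substF k u A) (substF k u B)"
| "substF k u (Forall A) = Forall (substF (Suc k) (liftT 0 u) A)"

definition inst :: "fm \<Rightarrow> trm \<Rightarrow> fm" where "inst A t = substF 0 t A"

fun closedT :: "nat \<Rightarrow> trm \<Rightarrow> bool" where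
  "closedT n (Var i) = (i < n)"
| "closedT n Zr = True"
| "closedT n (Sc t) = closedT n t"
| "closedT n (Pl t s) = (closedT n t \<and> closedT n s)"
| "closedT n (Tm t s) = (closedT n t \<and> closedT n s)"
| "closedT n (Ex2 t) = closedT n t"

fun closedF :: "nat \<Rightarrow> fm \<Rightarrow> bool" where
  "closedF n Fls = True"
| "closedF n (Eqt t s) = (closedT n t \<and> closedT n s)"
| "closedF n (Leq t s) = (closedT n t \<and> closedT n s)"
| "closedF n (Imp A B) = (closedF n A \<and> closedF n B)"
| "closedF n (Forall A) = closedF (Suc n) A"

definition sentence :: "fm \<Rightarrow> bool" where "sentence A = closedF 0 A"

fun close :: "nat \<Rightarrow> fm \<Rightarrow> fm" where
  "close 0 A = A"
| "close (Suc n) A = Forall (close n A)"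

fun num :: "nat \<Rightarrow> trm" where
  "num 0 = Zr"
| "num (Suc n) = Sc (num n)"

inductive Delta0 :: "fm \<Rightarrow> bool" where
  "Delta0 Fls"
| "Delta0 (Eqt t s)"
| "Delta0 (Leq t s)"
| "Delta0 A \<Longrightarrow> Delta0 B \<Longrightarrow> Delta0 (Imp A B)"
| "Delta0 A \<Longrightarrow> Delta0 (Forall (Imp (Leq (Var 0) (liftT 0 t)) A))"

inductive Pi1 :: "fm \<Rightarrow> bool" where
  "Delta0 A \<Longrightarrow> Pi1 A"
| "Pi1 A \<Longrightarrow> Pi1 (Forall A)"

inductive Sigma1 :: "fm \<Rightarrow> bool" where
  "Delta0 A \<Longrightarrow> Sigma1 A"
| "Sigma1 A \<Longrightarrow> Sigma1 (Exists A)"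

fun evalT :: "(nat \<Rightarrow> nat) \<Rightarrow> trm \<Rightarrow> nat" where
  "evalT e (Var i) = e i"
| "evalT e Zr = 0"
| "evalT e (Sc t) = Suc (evalT e t)"
| "evalT e (Pl t s) = evalT e t + evalT e s"
| "evalT e (Tm t s) = evalT e t * evalT e s"
| "evalT e (Ex2 t) = 2 ^ evalT e t"

fun evalF :: "(nat \<Rightarrow> nat) \<Rightarrow> fm \<Rightarrow> bool" where
  "evalF e Fls = False"
| "evalF e (Eqt t s) = (evalT e t = evalT e s)"
| "evalF e (Leq t s) = (evalT e t \<le> evalT e s)"
| "evalF e (Imp A B) = (evalF e A \<longrightarrow> evalF e B)"
| "evalF e (Forall A) = (\<forall>n. evalF (case_nat n e) A)"

fun codeT :: "trm \<Rightarrow> nat" where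
  "codeT (Var i) = prod_encode (0, i)"
| "codeT Zr = prod_encode (1, 0)"
| "codeT (Sc t) = prod_encode (2, codeT t)"
| "codeT (Pl t s) = prod_encode (3, prod_encode (codeT t, codeT s))"
| "codeT (Tm t s) = prod_encode (4, prod_encode (codeT t, codeT s))"
| "codeT (Ex2 t) = prod_encode (5, codeT t)"

fun codeF :: "fm \<Rightarrow> nat" where
  "codeF Fls = prod_encode (0, 0)"
| "codeF (Eqt t s) = prod_encode (1, prod_encode (codeT t, codeT s))"
| "codeF (Leq t s) = prod_encode (2, prod_encode (codeT t, codeT s))"
| "codeF (Imp A B) = prod_encode (3, prod_encode (codeF A, codeF B))"
| "codeF (Forall A) = prod_encode (4, codeF A)"

definition app_code :: "fm \<Rightarrow> fm \<Rightarrow> fm" where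
  "app_code \<rho> \<phi> = inst \<rho> (num (codeF \<phi>))"

section \<open>Hilbert-style proof calculus (hypotheses are sentences)\<close>

inductive proves :: "fm set \<Rightarrow> fm \<Rightarrow> bool" where
  hyp: "A \<in> \<Gamma> \<Longrightarrow> proves \<Gamma> A"
| axK: "proves \<Gamma> (Imp A (Imp B A))"
| axS: "proves \<Gamma> (Imp (Imp A (Imp B C)) (Imp (Imp A B) (Imp A C)))"
| axDN: "proves \<Gamma> (Imp (Imp (Imp A Fls) Fls) A)"
| axInst: "proves \<Gamma> (Imp (Forall A) (inst A t))"
| axAllImp: "proves \<Gamma> (Imp (Forall (Imp (liftF 0 A) B)) (Imp A (Forall B)))"
| axRefl: "proves \<Gamma> (Eqt t t)"
| axLeib: "proves \<Gamma> (Imp (Eqt t s) (Imp (inst A t) (inst A s)))"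
| mp: "proves \<Gamma> (Imp A B) \<Longrightarrow> proves \<Gamma> A \<Longrightarrow> proves \<Gamma> B"
| gen: "proves \<Gamma> A \<Longrightarrow> proves \<Gamma> (Forall A)"

definition consistent :: "fm set \<Rightarrow> bool" where
  "consistent T = (\<not> proves T Fls)"

section \<open>Elementary Arithmetic EA = I\<Delta>0 + Exp (in the language with 2^x)\<close>

definition indF :: "fm \<Rightarrow> fm" where
  "indF A = Imp (Conj (inst A Zr) (Forall (Imp A (substF 0 (Sc (Var 0)) (liftF 1 A))))) (Forall A)"

inductive_set EA :: "fm set" where
  "close 1 (Neg (Eqt (Sc (Var 0)) Zr)) \<in> EA"
| "close 2 (Imp (Eqt (Sc (Var 1)) (Sc (Var 0))) (Eqt (Var 1) (Var 0))) \<in> EA"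
| "close 1 (Eqt (Pl (Var 0) Zr) (Var 0)) \<in> EA"
| "close 2 (Eqt (Pl (Var 1) (Sc (Var 0))) (Sc (Pl (Var 1) (Var 0)))) \<in> EA"
| "close 1 (Eqt (Tm (Var 0) Zr) Zr) \<in> EA"
| "close 2 (Eqt (Tm (Var 1) (Sc (Var 0))) (Pl (Tm (Var 1) (Var 0)) (Var 1))) \<in> EA"
| "close 2 (Iff (Leq (Var 1) (Var 0)) (Exists (Eqt (Pl (Var 0) (Var 2)) (Var 1)))) \<in> EA"
| "Eqt (Ex2 Zr) (Sc Zr) \<in> EA"
| "close 1 (Eqt (Ex2 (Sc (Var 0))) (Pl (Ex2 (Var 0)) (Ex2 (Var 0)))) \<in> EA"
| "Delta0 A \<Longrightarrow> closedF (Suc n) A \<Longrightarrow> close n (indF A) \<in> EA"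

definition ce_theory :: "fm set \<Rightarrow> bool" where
  "ce_theory U = (\<exists>\<sigma>. Sigma1 \<sigma> \<and> closedF 1 \<sigma> \<and>
      (\<forall>n. n \<in> codeF ` U \<longleftrightarrow> evalF (\<lambda>_. 0) (inst \<sigma> (num n))))"

definition extends_EA :: "fm set \<Rightarrow> bool" where
  "extends_EA U = (\<forall>A\<in>EA. proves U A)"

end

theory Submission
  imports Defs
begin

text \<open>
  The formula is a Rosser sentence played by equivalence classes. At stage \<open>s\<close>, a code \<open>x \<le> s\<close> is
  identified with every code that the \<open>U\<close>-proofs of equivalences found up to \<open>s\<close> connect to it.
  Stage \<open>s\<close> is positive for \<open>x\<close> if some \<open>c\<close> in its class has by then been found with
  \<open>U \<turnstile> c \<rightarrow> \<rho>(c)\<close>, and negative if some \<open>c\<close> has been found with \<open>U \<turnstile> c \<rightarrow> \<not>\<rho>(c)\<close>; and \<open>\<rho>(x)\<close> says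
  that no positive stage comes strictly before all negative ones.

  If \<open>U + \<phi>\<close> is consistent, no actual number is a positive or negative stage for \<open>\<phi>\<close>: at the least
  stage for any member of the \<open>U\<close>-class of \<open>\<phi>\<close>, the responsible \<open>c\<close> itself has that stage, so \<open>EA\<close>
  decides \<open>\<rho>(c)\<close> against the proof found, and \<open>U\<close> refutes \<open>c\<close>. This gives independence. If moreover
  \<open>U \<turnstile> \<phi> \<leftrightarrow> \<psi>\<close>, the two codes are identified from some actual stage \<open>n\<close> on; below \<open>n\<close> nothing happens
  to either, which is a true bounded statement, and from \<open>n\<close> on they behave alike by pure logic.

  Inside \<open>\<rho>\<close>, classes are described by quantifying over all finite sets closed under the
  equivalences found so far, so that \<open>EA\<close> need not prove anything about them; and self-reference is obtained by
  applying a formula to its own numeral, the coded syntax being needed only in the standard model.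
\<close>

section \<open>Parallel substitution\<close>

fun psubT :: "(nat \<Rightarrow> trm) \<Rightarrow> trm \<Rightarrow> trm" where
  "psubT \<sigma> (Var i) = \<sigma> i"
| "psubT \<sigma> Zr = Zr"
| "psubT \<sigma> (Sc t) = Sc (psubT \<sigma> t)"
| "psubT \<sigma> (Pl t s) = Pl (psubT \<sigma> t) (psubT \<sigma> s)"
| "psubT \<sigma> (Tm t s) = Tm (psubT \<sigma> t) (psubT \<sigma> s)"
| "psubT \<sigma> (Ex2 t) = Ex2 (psubT \<sigma> t)"

definition up :: "(nat \<Rightarrow> trm) \<Rightarrow> nat \<Rightarrow> trm" where
  "up \<sigma> = case_nat (Var 0) (\<lambda>i. liftT 0 (\<sigma> i))"

fun psubF :: "(nat \<Rightarrow> trm) \<Rightarrow> fm \<Rightarrow> fm" where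
  "psubF \<sigma> Fls = Fls"
| "psubF \<sigma> (Eqt t s) = Eqt (psubT \<sigma> t) (psubT \<sigma> s)"
| "psubF \<sigma> (Leq t s) = Leq (psubT \<sigma> t) (psubT \<sigma> s)"
| "psubF \<sigma> (Imp A B) = Imp (psubF \<sigma> A) (psubF \<sigma> B)"
| "psubF \<sigma> (Forall A) = Forall (psubF (up \<sigma>) A)"

definition lift_var :: "nat \<Rightarrow> nat \<Rightarrow> trm" where
  "lift_var k i = Var (if i < k then i else Suc i)"

definition subst_var :: "nat \<Rightarrow> trm \<Rightarrow> nat \<Rightarrow> trm" where
  "subst_var k u i = (if i < k then Var i else if i = k then u else Var (i - 1))"

lemma up_0 [simp]: "up \<sigma> 0 = Var 0"
  and up_Suc [simp]: "up \<sigma> (Suc i) = liftT 0 (\<sigma> i)"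
  and up_numeral [simp]: "up \<sigma> (numeral n) = liftT 0 (\<sigma> (pred_numeral n))"
  by (simp_all add: up_def)

lemma up_Var [simp]: "up Var = Var"
  by (auto simp: up_def split: nat.splits)

lemma up_lift_var: "up (lift_var k) = lift_var (Suc k)"
  by (auto simp: up_def lift_var_def split: nat.splits)

lemma up_subst_var: "up (subst_var k u) = subst_var (Suc k) (liftT 0 u)"
  by (auto simp: up_def subst_var_def split: nat.splits)

lemma psubT_Var [simp]: "psubT Var t = t"
  by (induction t) auto

lemma psubF_Var [simp]: "psubF Var A = A"
  by (induction A) auto

lemma psubT_psubT [simp]: "psubT \<sigma> (psubT \<tau> t) = psubT (\<lambda>i. psubT \<sigma> (\<tau> i)) t"
  by (induction t) auto

lemma liftT_eq_psubT: "liftT k t = psubT (lift_var k) t"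
  by (induction t) (auto simp: lift_var_def)

lemma substT_eq_psubT: "substT k u t = psubT (subst_var k u) t"
  by (induction t) (auto simp: subst_var_def)

lemma liftF_eq_psubF: "liftF k A = psubF (lift_var k) A"
  by (induction A arbitrary: k) (auto simp: liftT_eq_psubT up_lift_var)

lemma substF_eq_psubF: "substF k u A = psubF (subst_var k u) A"
  by (induction A arbitrary: k u) (auto simp: substT_eq_psubT up_subst_var)

lemma lift_var_0: "lift_var 0 = (\<lambda>i. Var (Suc i))"
  by (simp add: lift_var_def fun_eq_iff)

lemma liftT_0: "liftT 0 t = psubT (\<lambda>i. Var (Suc i)) t"
  by (simp add: liftT_eq_psubT lift_var_0)

lemma liftF_0: "liftF 0 A = psubF (\<lambda>i. Var (Suc i)) A"
  by (simp add: liftF_eq_psubF lift_var_0)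

lemma inst_eq_psubF [simp]: "inst A t = psubF (case_nat t Var) A"
proof -
  have "subst_var 0 t = case_nat t Var"
    by (auto simp: subst_var_def split: nat.splits)
  then show ?thesis by (simp add: inst_def substF_eq_psubF)
qed

lemma case_nat_Var [simp]: "case_nat (Var 0) (\<lambda>i. Var (Suc i)) = Var"
  by (auto split: nat.splits)

lemma psubT_comp_case_nat [simp]:
  "(\<lambda>i. psubT \<sigma> (case_nat t \<tau> i)) = case_nat (psubT \<sigma> t) (\<lambda>i. psubT \<sigma> (\<tau> i))"
  by (auto split: nat.splits)

lemma psubT_case_nat_liftT [simp]: "psubT (case_nat t \<sigma>) (liftT 0 s) = psubT \<sigma> s"
  by (simp add: liftT_0)

lemma psubT_up_liftT [simp]: "psubT (up \<sigma>) (liftT 0 t) = liftT 0 (psubT \<sigma> t)"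
  by (simp add: liftT_0)

lemma psubT_case_nat_comp_up [simp]:
  "(\<lambda>i. psubT (case_nat t \<sigma>) (up \<tau> i)) = case_nat t (\<lambda>i. psubT \<sigma> (\<tau> i))"
  by (auto simp: up_def)

lemma psubT_up_comp_up [simp]: "(\<lambda>i. psubT (up \<sigma>) (up \<tau> i)) = up (\<lambda>i. psubT \<sigma> (\<tau> i))"
  by (simp add: up_def[of \<tau>] up_def[of "\<lambda>i. psubT \<sigma> (\<tau> i)"])

lemma psubF_psubF [simp]: "psubF \<sigma> (psubF \<tau> A) = psubF (\<lambda>i. psubT \<sigma> (\<tau> i)) A"
  by (induction A arbitrary: \<sigma> \<tau>) auto

lemma psubF_up_liftF: "psubF (up \<sigma>) (liftF 0 A) = liftF 0 (psubF \<sigma> A)"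
  by (simp add: liftF_0 liftT_0 flip: liftT_0)

lemma psubF_inst: "psubF \<sigma> (inst A t) = inst (psubF (up \<sigma>) A) (psubT \<sigma> t)"
  by simp

lemma psubF_Neg [simp]: "psubF \<sigma> (Neg A) = Neg (psubF \<sigma> A)"
  and psubF_Conj [simp]: "psubF \<sigma> (Conj A B) = Conj (psubF \<sigma> A) (psubF \<sigma> B)"
  and psubF_Disj [simp]: "psubF \<sigma> (Disj A B) = Disj (psubF \<sigma> A) (psubF \<sigma> B)"
  and psubF_Iff [simp]: "psubF \<sigma> (Iff A B) = Iff (psubF \<sigma> A) (psubF \<sigma> B)"
  and psubF_Exists [simp]: "psubF \<sigma> (Exists A) = Exists (psubF (up \<sigma>) A)"
  by (simp_all add: Neg_def Conj_def Disj_def Iff_def Exists_def)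

lemma liftF_Neg [simp]: "liftF k (Neg A) = Neg (liftF k A)"
  and liftF_Conj [simp]: "liftF k (Conj A B) = Conj (liftF k A) (liftF k B)"
  and liftF_Disj [simp]: "liftF k (Disj A B) = Disj (liftF k A) (liftF k B)"
  by (simp_all add: Neg_def Conj_def Disj_def)

lemma psubT_num [simp]: "psubT \<sigma> (num n) = num n"
  by (induction n) auto

lemma liftT_num [simp]: "liftT k (num n) = num n"
  by (induction n) auto

section \<open>Free variables\<close>

lemma closedT_num [simp]: "closedT k (num n)"
  by (induction n) auto

lemma closedF_Neg [simp]: "closedF n (Neg A) \<longleftrightarrow> closedF n A"
  and closedF_Conj [simp]: "closedF n (Conj A B) \<longleftrightarrow> closedF n A \<and> closedF n B"
  and closedF_Iff [simp]: "closedF n (Iff A B) \<longleftrightarrow> closedF n A \<and> closedF n B"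
  and closedF_Exists [simp]: "closedF n (Exists A) \<longleftrightarrow> closedF (Suc n) A"
  by (auto simp: Neg_def Conj_def Iff_def Exists_def)

lemma closedT_mono: "closedT m t \<Longrightarrow> m \<le> n \<Longrightarrow> closedT n t"
  by (induction t) auto

lemma closedF_mono: "closedF m A \<Longrightarrow> m \<le> n \<Longrightarrow> closedF n A"
  by (induction A arbitrary: m n) (auto intro: closedT_mono)

lemma closedT_ex: "\<exists>n. closedT n t"
proof (induction t)
  case (Pl t s)
  then show ?case
    using closedT_mono[OF _ max.cobounded1] closedT_mono[OF _ max.cobounded2] by fastforce
next
  case (Tm t s)
  then show ?case
    using closedT_mono[OF _ max.cobounded1] closedT_mono[OF _ max.cobounded2] by fastforce
qed auto

lemma closedF_ex: "\<exists>n. closedF n A"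
proof (induction A)
  case (Eqt t s)
  show ?case using closedT_ex[of "Pl t s"] by simp
next
  case (Leq t s)
  show ?case using closedT_ex[of "Pl t s"] by simp
next
  case (Imp A B)
  then show ?case
    using closedF_mono[OF _ max.cobounded1] closedF_mono[OF _ max.cobounded2] by fastforce
next
  case (Forall A)
  then obtain n where "closedF n A" by blast
  then have "closedF (Suc n) A" by (rule closedF_mono) simp
  then show ?case by auto
qed simp

lemma psubT_cong_closed: "closedT n t \<Longrightarrow> (\<And>i. i < n \<Longrightarrow> \<sigma> i = \<tau> i) \<Longrightarrow> psubT \<sigma> t = psubT \<tau> t"
  by (induction t) auto

lemma psubF_cong_closed: "closedF n A \<Longrightarrow> (\<And>i. i < n \<Longrightarrow> \<sigma> i = \<tau> i) \<Longrightarrow> psubF \<sigma> A = psubF \<tau> A"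
proof (induction A arbitrary: n \<sigma> \<tau>)
  case (Forall A)
  have "psubF (up \<sigma>) A = psubF (up \<tau>) A"
    by (rule Forall.IH[of "Suc n"]) (use Forall.prems in \<open>auto simp: up_def split: nat.splits\<close>)
  then show ?case by simp
next
  case (Imp A B)
  show ?case using Imp.IH[of n \<sigma> \<tau>] Imp.prems by simp
qed (auto intro: psubT_cong_closed)

lemma psubF_sentence: "sentence A \<Longrightarrow> psubF \<sigma> A = A"
  using psubF_cong_closed[of 0 A \<sigma> Var] by (simp add: sentence_def)

lemma closedT_psubT: "closedT n t \<Longrightarrow> (\<And>i. i < n \<Longrightarrow> closedT m (\<sigma> i)) \<Longrightarrow> closedT m (psubT \<sigma> t)"
  by (induction t) auto

lemma closedT_liftT: "closedT n t \<Longrightarrow> closedT (Suc n) (liftT 0 t)"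
  by (simp add: liftT_0 closedT_psubT)

lemma closedF_psubF: "closedF n A \<Longrightarrow> (\<And>i. i < n \<Longrightarrow> closedT m (\<sigma> i)) \<Longrightarrow> closedF m (psubF \<sigma> A)"
proof (induction A arbitrary: n m \<sigma>)
  case (Forall A)
  have "closedF (Suc m) (psubF (up \<sigma>) A)"
    by (rule Forall.IH[of "Suc n"])
      (use Forall.prems in \<open>auto simp: up_def closedT_liftT split: nat.splits\<close>)
  then show ?case by simp
next
  case (Imp A B)
  show ?case using Imp.IH[of n m \<sigma>] Imp.prems by simp
qed (auto intro: closedT_psubT)

section \<open>Truth and bounded quantifiers\<close>

definition BAll :: "trm \<Rightarrow> fm \<Rightarrow> fm" where
  "BAll t A = Forall (Imp (Leq (Var 0) (liftT 0 t)) A)"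

definition BEx :: "trm \<Rightarrow> fm \<Rightarrow> fm" where
  "BEx t A = Neg (BAll t (Neg A))"

lemma psubF_BAll [simp]: "psubF \<sigma> (BAll t A) = BAll (psubT \<sigma> t) (psubF (up \<sigma>) A)"
  and psubF_BEx [simp]: "psubF \<sigma> (BEx t A) = BEx (psubT \<sigma> t) (psubF (up \<sigma>) A)"
  by (simp_all add: BAll_def BEx_def)

lemma closedF_BAll [simp]: "closedF n (BAll t A) \<longleftrightarrow> closedT (Suc n) (liftT 0 t) \<and> closedF (Suc n) A"
  and closedF_BEx [simp]: "closedF n (BEx t A) \<longleftrightarrow> closedT (Suc n) (liftT 0 t) \<and> closedF (Suc n) A"
  by (auto simp: BAll_def BEx_def)

lemma evalT_num [simp]: "evalT e (num n) = n"
  by (induction n) auto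

lemma evalT_psubT: "evalT e (psubT \<sigma> t) = evalT (\<lambda>i. evalT e (\<sigma> i)) t"
  by (induction t) auto

lemma evalT_liftT [simp]: "evalT (case_nat n e) (liftT 0 t) = evalT e t"
  by (simp add: liftT_0 evalT_psubT)

lemma evalT_case_nat_comp_up [simp]:
  "(\<lambda>i. evalT (case_nat n e) (up \<sigma> i)) = case_nat n (\<lambda>i. evalT e (\<sigma> i))"
  by (auto simp: up_def split: nat.splits)

lemma evalF_psubF: "evalF e (psubF \<sigma> A) = evalF (\<lambda>i. evalT e (\<sigma> i)) A"
  by (induction A arbitrary: e \<sigma>) (auto simp: evalT_psubT)

lemma evalT_cong_closed: "closedT n t \<Longrightarrow> (\<And>i. i < n \<Longrightarrow> e i = e' i) \<Longrightarrow> evalT e t = evalT e' t"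
  by (induction t) auto

lemma evalF_cong_closed: "closedF n A \<Longrightarrow> (\<And>i. i < n \<Longrightarrow> e i = e' i) \<Longrightarrow> evalF e A = evalF e' A"
proof (induction A arbitrary: n e e')
  case (Eqt t s)
  show ?case using evalT_cong_closed[of n _ e e'] Eqt.prems by simp
next
  case (Leq t s)
  show ?case using evalT_cong_closed[of n _ e e'] Leq.prems by simp
next
  case (Imp A B)
  show ?case using Imp.IH[of n e e'] Imp.prems by simp
next
  case (Forall A)
  have "evalF (case_nat m e) A = evalF (case_nat m e') A" for m
    by (rule Forall.IH[of "Suc n"]) (use Forall.prems in \<open>auto split: nat.splits\<close>)
  then show ?case by simp
qed simp

lemma evalF_Neg [simp]: "evalF e (Neg A) \<longleftrightarrow> \<not> evalF e A"
  and evalF_Conj [simp]: "evalF e (Conj A B) \<longleftrightarrow> evalF e A \<and> evalF e B"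
  and evalF_Disj [simp]: "evalF e (Disj A B) \<longleftrightarrow> evalF e A \<or> evalF e B"
  and evalF_Exists [simp]: "evalF e (Exists A) \<longleftrightarrow> (\<exists>n. evalF (case_nat n e) A)"
  by (auto simp: Neg_def Conj_def Disj_def Exists_def)

lemma evalF_BAll [simp]: "evalF e (BAll t A) \<longleftrightarrow> (\<forall>n \<le> evalT e t. evalF (case_nat n e) A)"
  and evalF_BEx [simp]: "evalF e (BEx t A) \<longleftrightarrow> (\<exists>n \<le> evalT e t. evalF (case_nat n e) A)"
  by (auto simp: BAll_def BEx_def)

lemma Delta0_Neg [intro]: "Delta0 A \<Longrightarrow> Delta0 (Neg A)"
  by (auto simp: Neg_def intro: Delta0.intros)

lemma Delta0_Conj [intro]: "Delta0 A \<Longrightarrow> Delta0 B \<Longrightarrow> Delta0 (Conj A B)"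
  by (auto simp: Conj_def intro: Delta0.intros)

lemma Delta0_Disj [intro]: "Delta0 A \<Longrightarrow> Delta0 B \<Longrightarrow> Delta0 (Disj A B)"
  by (auto simp: Disj_def intro: Delta0.intros)

lemma Delta0_BAll [intro]: "Delta0 A \<Longrightarrow> Delta0 (BAll t A)"
  by (auto simp: BAll_def intro: Delta0.intros)

lemma Delta0_BEx [intro]: "Delta0 A \<Longrightarrow> Delta0 (BEx t A)"
  by (auto simp: BEx_def)

lemma Delta0_psubF: "Delta0 A \<Longrightarrow> Delta0 (psubF \<sigma> A)"
  by (induction A arbitrary: \<sigma> rule: Delta0.induct) (auto intro: Delta0.intros)

section \<open>Application to argument lists\<close>

text \<open>Missing arguments are read as zero: \<open>ap A ts\<close> has no free variables beyond those of \<open>ts\<close>.\<close>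

definition args :: "trm list \<Rightarrow> nat \<Rightarrow> trm" where
  "args ts i = (if i < length ts then ts ! i else Zr)"

definition env :: "nat list \<Rightarrow> nat \<Rightarrow> nat" where
  "env xs i = (if i < length xs then xs ! i else 0)"

abbreviation ap :: "fm \<Rightarrow> trm list \<Rightarrow> fm" where
  "ap A ts \<equiv> psubF (args ts) A"

lemma args_Cons_0 [simp]: "args (t # ts) 0 = t"
  and args_Cons_Suc [simp]: "args (t # ts) (Suc i) = args ts i"
  and args_Cons_numeral [simp]: "args (t # ts) (numeral n) = args ts (pred_numeral n)"
  by (simp_all add: args_def numeral_eq_Suc)

lemma env_Cons_0 [simp]: "env (x # xs) 0 = x"
  and env_Cons_Suc [simp]: "env (x # xs) (Suc i) = env xs i"
  and env_Cons_numeral [simp]: "env (x # xs) (numeral n) = env xs (pred_numeral n)"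
  by (simp_all add: env_def numeral_eq_Suc)

lemma case_nat_env [simp]: "case_nat x (env xs) = env (x # xs)"
  by (auto split: nat.splits)

lemma psubT_comp_args [simp]: "(\<lambda>i. psubT \<sigma> (args ts i)) = args (map (psubT \<sigma>) ts)"
  by (auto simp: args_def)

lemma evalT_comp_args: "(\<lambda>i. evalT e (args ts i)) = env (map (evalT e) ts)"
  by (auto simp: args_def env_def)

lemma evalF_ap [simp]: "evalF e (ap A ts) = evalF (env (map (evalT e) ts)) A"
  by (simp add: evalF_psubF evalT_comp_args)

lemma args_map_num: "args (map num xs) = (\<lambda>i. num (env xs i))"
  by (auto simp: args_def env_def)

lemma closedF_ap: "\<forall>t \<in> set ts. closedT m t \<Longrightarrow> closedF m (ap A ts)"
  using closedF_ex[of A] closedF_psubF[of _ A m "args ts"] by (auto simp: args_def)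

section \<open>Propositional consequence\<close>

fun holds :: "(fm \<Rightarrow> bool) \<Rightarrow> fm \<Rightarrow> bool" where
  "holds v Fls = False"
| "holds v (Imp A B) = (holds v A \<longrightarrow> holds v B)"
| "holds v (Eqt t s) = v (Eqt t s)"
| "holds v (Leq t s) = v (Leq t s)"
| "holds v (Forall A) = v (Forall A)"

lemma holds_Neg [simp]: "holds v (Neg A) \<longleftrightarrow> \<not> holds v A"
  and holds_Conj [simp]: "holds v (Conj A B) \<longleftrightarrow> holds v A \<and> holds v B"
  and holds_Disj [simp]: "holds v (Disj A B) \<longleftrightarrow> holds v A \<or> holds v B"
  and holds_Iff [simp]: "holds v (Iff A B) \<longleftrightarrow> (holds v A \<longleftrightarrow> holds v B)"
  and holds_BEx: "holds v (BEx t A) \<longleftrightarrow> \<not> holds v (BAll t (Neg A))"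
  and holds_Exists: "holds v (Exists A) \<longleftrightarrow> \<not> holds v (Forall (Neg A))"
  by (auto simp: Neg_def Conj_def Disj_def Iff_def BEx_def Exists_def)

locale mp_closed =
  fixes S :: "fm set"
  assumes axK: "Imp A (Imp B A) \<in> S"
    and axS: "Imp (Imp A (Imp B C)) (Imp (Imp A B) (Imp A C)) \<in> S"
    and axDN: "Imp (Imp (Imp A Fls) Fls) A \<in> S"
    and mp: "Imp A B \<in> S \<Longrightarrow> A \<in> S \<Longrightarrow> B \<in> S"
begin

lemma Imp_weaken: "B \<in> S \<Longrightarrow> Imp A B \<in> S"
  by (rule mp[OF axK])

lemma Imp_mp: "Imp A (Imp B C) \<in> S \<Longrightarrow> Imp A B \<in> S \<Longrightarrow> Imp A C \<in> S"
  by (rule mp[OF mp[OF axS]])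

lemma Imp_refl: "Imp A A \<in> S"
  by (rule Imp_mp[OF axK axK])

lemma Imp_trans: "Imp A B \<in> S \<Longrightarrow> Imp B C \<in> S \<Longrightarrow> Imp A C \<in> S"
  by (rule Imp_mp[OF Imp_weaken])

lemma ex_falso: "Imp Fls A \<in> S"
  by (rule Imp_trans[OF axK axDN])

lemma mp_closed_Imp: "mp_closed {B. Imp A B \<in> S}"
  by unfold_locales (auto intro: Imp_weaken axK axS axDN Imp_mp)

end

lemma mp_closed_Union_chain:
  assumes "subset.chain {S. mp_closed S} \<C>" and "\<C> \<noteq> {}"
  shows "mp_closed (\<Union>\<C>)"
proof -
  have closed: "mp_closed X" if "X \<in> \<C>" for X
    using assms(1) that unfolding subset.chain_def by blast
  obtain X where X: "X \<in> \<C>" using assms(2) by blast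
  show ?thesis
  proof
    fix A B assume "Imp A B \<in> \<Union>\<C>" "A \<in> \<Union>\<C>"
    then obtain Y Z where "Y \<in> \<C>" "Imp A B \<in> Y" "Z \<in> \<C>" "A \<in> Z" by blast
    moreover from this have "Y \<subseteq> Z \<or> Z \<subseteq> Y" using assms(1) unfolding subset.chain_def by blast
    ultimately obtain W where W: "W \<in> \<C>" "Imp A B \<in> W" "A \<in> W" by blast
    then show "B \<in> \<Union>\<C>" using mp_closed.mp[OF closed] by blast
  qed (use X mp_closed.axK[OF closed] mp_closed.axS[OF closed] mp_closed.axDN[OF closed] in blast)+
qed

locale maximal_mp_closed = mp_closed M for M +
  fixes C :: fm
  assumes avoids: "C \<notin> M"
    and maximal: "mp_closed X \<Longrightarrow> M \<subseteq> X \<Longrightarrow> C \<notin> X \<Longrightarrow> X = M"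
begin

lemma Imp_C_if_not_mem:
  assumes "A \<notin> M"
  shows "Imp A C \<in> M"
  using maximal[OF mp_closed_Imp, of A] Imp_weaken Imp_refl assms by blast

lemma Fls_not_mem: "Fls \<notin> M"
  using ex_falso mp avoids by blast

text \<open>Otherwise \<open>A \<rightarrow> C\<close> and \<open>\<not>A \<rightarrow> C\<close> are both in \<open>M\<close>, and \<open>M\<close> extended by \<open>\<not>C\<close> derives \<open>C\<close>.\<close>

lemma Neg_mem_if_not_mem:
  assumes "A \<notin> M"
  shows "Imp A Fls \<in> M"
proof (rule ccontr)
  assume not: "Imp A Fls \<notin> M"
  interpret N: mp_closed "{B. Imp (Imp C Fls) B \<in> M}" by (rule mp_closed_Imp)
  have "Imp C Fls \<in> {B. Imp (Imp C Fls) B \<in> M}" and "Imp A C \<in> {B. Imp (Imp C Fls) B \<in> M}"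
    and "Imp (Imp A Fls) C \<in> {B. Imp (Imp C Fls) B \<in> M}"
    using Imp_refl Imp_weaken Imp_C_if_not_mem assms not by blast+
  then have "Fls \<in> {B. Imp (Imp C Fls) B \<in> M}" using N.Imp_trans N.mp by blast
  then show False using axDN mp avoids by blast
qed

lemma Imp_mem_iff: "Imp A B \<in> M \<longleftrightarrow> (A \<in> M \<longrightarrow> B \<in> M)"
  using mp Imp_weaken Neg_mem_if_not_mem Imp_trans[OF _ ex_falso] by blast

lemma holds_mem_iff: "holds (\<lambda>A. A \<in> M) A \<longleftrightarrow> A \<in> M"
  by (induction A) (auto simp: Imp_mem_iff Fls_not_mem)

end

lemma mp_closed_separation:
  assumes "mp_closed S" and "C \<notin> S"
  obtains v where "\<forall>A \<in> S. holds v A" and "\<not> holds v C"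
proof -
  define F where "F = {X. mp_closed X \<and> S \<subseteq> X \<and> C \<notin> X}"
  have "\<exists>M \<in> F. \<forall>X \<in> F. M \<subseteq> X \<longrightarrow> X = M"
  proof (rule subset_Zorn_nonempty)
    show "F \<noteq> {}" using assms by (auto simp: F_def)
  next
    fix \<C> assume "\<C> \<noteq> {}" and chain: "subset.chain F \<C>"
    then have "mp_closed (\<Union>\<C>)"
      by (intro mp_closed_Union_chain) (auto simp: subset.chain_def F_def)
    then show "\<Union>\<C> \<in> F"
      using \<open>\<C> \<noteq> {}\<close> chain unfolding subset.chain_def F_def by blast
  qed
  then obtain M where M: "M \<in> F" and maximal: "\<And>X. X \<in> F \<Longrightarrow> M \<subseteq> X \<Longrightarrow> X = M" by blast
  interpret mp_closed M using M by (simp add: F_def)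
  interpret maximal_mp_closed M C
    using M maximal by unfold_locales (auto simp: F_def)
  show ?thesis
    by (rule that[of "\<lambda>A. A \<in> M"]) (use M avoids in \<open>auto simp: holds_mem_iff F_def\<close>)
qed

lemma tautological_consequence:
  assumes "\<forall>A \<in> set As. proves T A" and "\<And>v. \<forall>A \<in> set As. holds v A \<Longrightarrow> holds v C"
  shows "proves T C"
proof (rule ccontr)
  assume "\<not> proves T C"
  moreover have "mp_closed {A. proves T A}"
    by unfold_locales (auto intro: proves.intros)
  ultimately obtain v where "\<forall>A \<in> {A. proves T A}. holds v A" "\<not> holds v C"
    using mp_closed_separation by blast
  then show False using assms by blast
qed

lemma taut: "(\<And>v. holds v C) \<Longrightarrow> proves T C"
  using tautological_consequence[of "[]" T C] by simp

lemma taut_conseq1: "proves T A \<Longrightarrow> (\<And>v. holds v A \<Longrightarrow> holds v C) \<Longrightarrow> proves T C"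
  using tautological_consequence[of "[A]" T C] by simp

lemma taut_conseq2:
  "proves T A \<Longrightarrow> proves T B \<Longrightarrow> (\<And>v. holds v A \<Longrightarrow> holds v B \<Longrightarrow> holds v C) \<Longrightarrow> proves T C"
  using tautological_consequence[of "[A, B]" T C] by simp

lemma taut_conseq3:
  "proves T A \<Longrightarrow> proves T B \<Longrightarrow> proves T D
    \<Longrightarrow> (\<And>v. holds v A \<Longrightarrow> holds v B \<Longrightarrow> holds v D \<Longrightarrow> holds v C) \<Longrightarrow> proves T C"
  using tautological_consequence[of "[A, B, D]" T C] by simp

lemma proves_Neg_cong: "proves T (Iff A B) \<Longrightarrow> proves T (Neg A) \<longleftrightarrow> proves T (Neg B)"
  using taut_conseq2[of T "Iff A B" "Neg A" "Neg B"] taut_conseq2[of T "Iff A B" "Neg B" "Neg A"]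
  by auto

section \<open>First-order derivations\<close>

lemma proves_cut: "proves T A \<Longrightarrow> \<forall>B \<in> T. proves S B \<Longrightarrow> proves S A"
proof (induction rule: proves.induct)
  case (mp T A B)
  then show ?case by (blast intro: proves.mp)
qed (blast intro: proves.intros)+

lemma proves_psubF: "proves T A \<Longrightarrow> \<forall>B \<in> T. sentence B \<Longrightarrow> proves T (psubF \<sigma> A)"
proof (induction arbitrary: \<sigma> rule: proves.induct)
  case (hyp A T)
  then show ?case by (simp add: psubF_sentence proves.hyp)
next
  case (mp T A B)
  then have "proves T (Imp (psubF \<sigma> A) (psubF \<sigma> B))" and "proves T (psubF \<sigma> A)"
    by (metis psubF.simps(4))+
  then show ?case by (rule proves.mp)
qed (simp_all only: psubF.simps psubF_inst psubF_up_liftF proves.intros)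

lemma ForallI: "proves T (Imp (liftF 0 H) A) \<Longrightarrow> proves T (Imp H (Forall A))"
  by (rule mp[OF axAllImp gen])

lemma ForallE: "proves T (Imp (psubF \<sigma> (Forall A)) (psubF (case_nat t \<sigma>) A))"
  using axInst[of T "psubF (up \<sigma>) A" t] by simp

lemma liftF_ForallE: "proves T (Imp (liftF 0 (Forall A)) A)"
  unfolding liftF_0 using ForallE[of T "\<lambda>i. Var (Suc i)" A "Var 0"] by simp

lemma ExistsI: "proves T (Imp (inst A t) (Exists A))"
  by (rule taut_conseq1[OF ForallE[of _ Var "Neg A" t]]) (auto simp: holds_Exists)

lemma ExistsE:
  assumes "proves T (Imp A (liftF 0 C))"
  shows "proves T (Imp (Exists A) C)"
proof -
  have "proves T (Imp (liftF 0 (Neg C)) (Neg A))"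
    by (rule taut_conseq1[OF assms]) auto
  then show ?thesis
    by (rule taut_conseq1[OF ForallI]) (auto simp: holds_Exists)
qed

lemma Forall_mono:
  assumes "proves T (Imp A B)"
  shows "proves T (Imp (Forall A) (Forall B))"
  by (rule ForallI) (rule taut_conseq2[OF liftF_ForallE[of _ A] assms], simp)

lemma Forall_cong:
  assumes "proves T (Iff A B)"
  shows "proves T (Iff (Forall A) (Forall B))"
proof -
  have "proves T (Imp A B)" and "proves T (Imp B A)"
    by (rule taut_conseq1[OF assms], simp)+
  from this[THEN Forall_mono] show ?thesis by (rule taut_conseq2) auto
qed

lemma BAllI:
  "proves T (Imp (liftF 0 H) (Imp (Leq (Var 0) (liftT 0 t)) A)) \<Longrightarrow> proves T (Imp H (BAll t A))"
  unfolding BAll_def by (rule ForallI)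

lemma BAllE:
  "proves T (Imp (psubF \<sigma> (BAll t A)) (Imp (Leq u (psubT \<sigma> t)) (psubF (case_nat u \<sigma>) A)))"
  using ForallE[of T \<sigma> "Imp (Leq (Var 0) (liftT 0 t)) A" u] by (simp add: BAll_def)

lemma BExI: "proves T (Imp (Leq u t) (Imp (inst A u) (BEx t A)))"
  by (rule taut_conseq1[OF BAllE[of _ Var t "Neg A" u]]) (auto simp: holds_BEx)

lemma BAll_mono:
  assumes "proves T (Imp (liftF 0 H) (Imp A B))"
  shows "proves T (Imp H (Imp (BAll t A) (BAll t B)))"
proof -
  have "proves T (Imp (liftF 0 (Conj H (BAll t A))) (Imp (Leq (Var 0) (liftT 0 t)) B))"
    by (rule taut_conseq2[OF assms liftF_ForallE[of _ "Imp (Leq (Var 0) (liftT 0 t)) A"]])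
      (simp add: BAll_def)
  then show ?thesis by (rule taut_conseq1[OF BAllI]) simp
qed

lemma BAll_cong:
  assumes "proves T (Iff A B)"
  shows "proves T (Iff (BAll t A) (BAll t B))"
  unfolding BAll_def by (rule Forall_cong, rule taut_conseq1[OF assms]) simp

lemma BEx_cong:
  assumes "proves T (Iff A B)"
  shows "proves T (Iff (BEx t A) (BEx t B))"
proof -
  have "proves T (Iff (Neg A) (Neg B))" by (rule taut_conseq1[OF assms]) simp
  from BAll_cong[OF this, of t] show ?thesis by (rule taut_conseq1) (simp add: holds_BEx)
qed

lemma ForallD:
  assumes "\<forall>B \<in> T. sentence B" and "proves T (Forall A)"
  shows "proves T A"
  by (rule mp[OF liftF_ForallE]) (simp only: liftF_0 proves_psubF[OF assms(2,1)])

lemma closeD: "\<forall>B \<in> T. sentence B \<Longrightarrow> proves T (close n A) \<Longrightarrow> proves T A"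
  by (induction n) (auto dest: ForallD)

lemma deduction_theorem:
  assumes "proves (insert A T) B" and "sentence A"
  shows "proves T (Imp A B)"
  using assms(1)
proof (induction "insert A T" B rule: proves.induct)
  case (hyp B)
  then show ?case by (cases "B = A") (auto intro: taut mp[OF proves.axK] proves.hyp)
next
  case (mp B C)
  then show ?case by (blast intro: proves.mp proves.axS)
next
  case (gen B)
  have "liftF 0 A = A" using assms(2) by (simp add: liftF_0 psubF_sentence)
  then show ?case using ForallI gen by metis
qed (rule proves.mp[OF proves.axK], rule proves.intros)+

lemma proves_insert_iff:
  assumes "sentence A"
  shows "proves (insert A T) B \<longleftrightarrow> proves T (Imp A B)"
proof
  assume "proves T (Imp A B)"
  then have "proves (insert A T) (Imp A B)" by (rule proves_cut) (auto intro: hyp)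
  then show "proves (insert A T) B" by (rule mp) (auto intro: hyp)
qed (rule deduction_theorem[OF _ assms])

lemma consistent_insert_iff: "sentence A \<Longrightarrow> consistent (insert A T) \<longleftrightarrow> \<not> proves T (Neg A)"
  by (simp add: consistent_def proves_insert_iff Neg_def)

section \<open>Equality\<close>

lemma eq_subst: "proves T (Imp (Eqt t s) (Imp (psubF (case_nat t \<sigma>) A) (psubF (case_nat s \<sigma>) A)))"
  using axLeib[of T t s "psubF (up \<sigma>) A"] by simp

lemma eq_sym: "proves T (Imp (Eqt t s) (Eqt s t))"
  by (rule taut_conseq2[OF axRefl[of _ t] eq_subst[of _ t s Var "Eqt (Var 0) (liftT 0 t)"]]) simp

lemma eq_trans: "proves T (Imp (Eqt t s) (Imp (Eqt s u) (Eqt t u)))"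
  by (rule taut_conseq1[OF eq_subst[of _ s u Var "Eqt (liftT 0 t) (Var 0)"]]) simp

lemma eq_symD: "proves T (Eqt t s) \<Longrightarrow> proves T (Eqt s t)"
  using eq_sym mp by blast

lemma eq_transD [trans]: "proves T (Eqt t s) \<Longrightarrow> proves T (Eqt s u) \<Longrightarrow> proves T (Eqt t u)"
  using eq_trans mp by blast

lemma eq_subst_term:
  "proves T (Imp (Eqt t s) (Eqt (psubT (case_nat t \<sigma>) u) (psubT (case_nat s \<sigma>) u)))"
  by (rule taut_conseq2[OF eq_subst[of _ t s Var
          "Eqt (liftT 0 (psubT (case_nat t \<sigma>) u)) (psubT (up \<sigma>) u)"]
        axRefl[of _ "psubT (case_nat t \<sigma>) u"]]) simp

lemma eq_Sc: "proves T (Imp (Eqt t s) (Eqt (Sc t) (Sc s)))"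
  using eq_subst_term[of T t s Var "Sc (Var 0)"] by simp

lemma eq_ScD: "proves T (Eqt t s) \<Longrightarrow> proves T (Eqt (Sc t) (Sc s))"
  using eq_Sc mp by blast

lemma eq_Ex2D: "proves T (Eqt t s) \<Longrightarrow> proves T (Eqt (Ex2 t) (Ex2 s))"
  using eq_subst_term[of T t s Var "Ex2 (Var 0)"] by (auto intro: mp)

lemma eq_PlD:
  assumes "proves T (Eqt t s)" and "proves T (Eqt t' s')"
  shows "proves T (Eqt (Pl t t') (Pl s s'))"
proof -
  have "proves T (Eqt (Pl t t') (Pl s t'))"
    using mp[OF eq_subst_term[of T t s Var "Pl (Var 0) (liftT 0 t')"] assms(1)] by simp
  also have "proves T (Eqt (Pl s t') (Pl s s'))"
    using mp[OF eq_subst_term[of T t' s' Var "Pl (liftT 0 s) (Var 0)"] assms(2)] by simp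
  finally show ?thesis .
qed

lemma eq_TmD:
  assumes "proves T (Eqt t s)" and "proves T (Eqt t' s')"
  shows "proves T (Eqt (Tm t t') (Tm s s'))"
proof -
  have "proves T (Eqt (Tm t t') (Tm s t'))"
    using mp[OF eq_subst_term[of T t s Var "Tm (Var 0) (liftT 0 t')"] assms(1)] by simp
  also have "proves T (Eqt (Tm s t') (Tm s s'))"
    using mp[OF eq_subst_term[of T t' s' Var "Tm (liftT 0 s) (Var 0)"] assms(2)] by simp
  finally show ?thesis .
qed

lemma eq_subst_iff:
  assumes "proves T (Eqt t s)"
  shows "proves T (Iff (psubF (case_nat t \<sigma>) A) (psubF (case_nat s \<sigma>) A))"
  by (rule taut_conseq2[OF mp[OF eq_subst assms] mp[OF eq_subst eq_symD[OF assms]]]) auto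

lemma Eqt_cong:
  assumes "proves T (Eqt t t')" and "proves T (Eqt s s')"
  shows "proves T (Iff (Eqt t s) (Eqt t' s'))"
  using taut_conseq2[OF eq_subst_iff[OF assms(1), of Var "Eqt (Var 0) (liftT 0 s)"]
      eq_subst_iff[OF assms(2), of Var "Eqt (liftT 0 t') (Var 0)"], of "Iff (Eqt t s) (Eqt t' s')"]
  by simp

lemma Leq_cong:
  assumes "proves T (Eqt t t')" and "proves T (Eqt s s')"
  shows "proves T (Iff (Leq t s) (Leq t' s'))"
  using taut_conseq2[OF eq_subst_iff[OF assms(1), of Var "Leq (Var 0) (liftT 0 s)"]
      eq_subst_iff[OF assms(2), of Var "Leq (liftT 0 t') (Var 0)"], of "Iff (Leq t s) (Leq t' s')"]
  by simp

lemma BAll_bound_cong: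
  assumes "proves T (Eqt t s)"
  shows "proves T (Iff (BAll t A) (BAll s A))"
  using eq_subst_iff[OF assms, of Var "BAll (Var 0) (psubF (up (\<lambda>i. Var (Suc i))) A)"] by simp

section \<open>Arithmetic in EA\<close>

lemma closedF_close: "closedF m (close n A) = closedF (m + n) A"
  by (induction n arbitrary: m) auto

lemma closedF_indF: "closedF (Suc n) A \<Longrightarrow> closedF n (indF A)"
  unfolding indF_def inst_eq_psubF substF_eq_psubF liftF_eq_psubF
  by (auto simp: subst_var_def lift_var_def split: nat.splits intro!: closedF_psubF[of "Suc n"])

lemma EA_sentences: "\<forall>A \<in> EA. sentence A"
proof
  fix A assume "A \<in> EA"
  then show "sentence A"
    by cases (auto simp: sentence_def closedF_close closedF_indF numeral_2_eq_2)
qed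

lemma EA_psubF: "proves EA A \<Longrightarrow> proves EA (psubF \<sigma> A)"
  using proves_psubF EA_sentences by blast

lemma EA_axiom: "close n A \<in> EA \<Longrightarrow> proves EA (psubF \<sigma> A)"
  using EA_psubF closeD[OF EA_sentences] hyp by blast

lemma EA_Sc_neq_Zr: "proves EA (Neg (Eqt (Sc t) Zr))"
  using EA_axiom[OF EA.intros(1), of "case_nat t Var"] by simp

lemma EA_Sc_inj: "proves EA (Imp (Eqt (Sc t) (Sc s)) (Eqt t s))"
  using EA_axiom[OF EA.intros(2), of "case_nat s (case_nat t Var)"] by simp

lemma EA_Pl_Zr: "proves EA (Eqt (Pl t Zr) t)"
  using EA_axiom[OF EA.intros(3), of "case_nat t Var"] by simp

lemma EA_Pl_Sc: "proves EA (Eqt (Pl t (Sc s)) (Sc (Pl t s)))"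
  using EA_axiom[OF EA.intros(4), of "case_nat s (case_nat t Var)"] by simp

lemma EA_Tm_Zr: "proves EA (Eqt (Tm t Zr) Zr)"
  using EA_axiom[OF EA.intros(5), of "case_nat t Var"] by simp

lemma EA_Tm_Sc: "proves EA (Eqt (Tm t (Sc s)) (Pl (Tm t s) t))"
  using EA_axiom[OF EA.intros(6), of "case_nat s (case_nat t Var)"] by simp

lemma EA_Leq_iff_Exists:
  "proves EA (Iff (Leq t s) (Exists (Eqt (Pl (Var 0) (liftT 0 t)) (liftT 0 s))))"
  using EA_axiom[OF EA.intros(7), of "case_nat s (case_nat t Var)"] by simp

lemma EA_Ex2_Zr: "proves EA (Eqt (Ex2 Zr) (Sc Zr))"
  by (rule hyp, rule EA.intros)

lemma EA_Ex2_Sc: "proves EA (Eqt (Ex2 (Sc t)) (Pl (Ex2 t) (Ex2 t)))"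
  using EA_axiom[OF EA.intros(9), of "case_nat t Var"] by simp

abbreviation inst_Sc :: "fm \<Rightarrow> fm" where
  "inst_Sc A \<equiv> psubF (case_nat (Sc (Var 0)) (\<lambda>i. Var (Suc i))) A"

lemma EA_induct:
  assumes "Delta0 A" and base: "proves EA (inst A Zr)"
    and step: "proves EA (Imp A (inst_Sc A))"
  shows "proves EA A"
proof -
  obtain n where "closedF n A" using closedF_ex by blast
  then have "closedF (Suc n) A" by (rule closedF_mono) simp
  then have "proves EA (indF A)"
    using EA_axiom[of n "indF A" Var] EA.intros(10)[OF assms(1)] by simp
  moreover have "(\<lambda>i. psubT (subst_var 0 (Sc (Var 0))) (lift_var 1 i)) =
      case_nat (Sc (Var 0)) (\<lambda>i. Var (Suc i))"
    by (auto simp: subst_var_def lift_var_def split: nat.splits)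
  ultimately have "proves EA (Imp (Conj (inst A Zr) (Forall (Imp A (inst_Sc A)))) (Forall A))"
    by (simp add: indF_def substF_eq_psubF liftF_eq_psubF)
  then have "proves EA (Forall A)"
    by (rule taut_conseq3[OF _ base gen[OF step]]) simp
  then show ?thesis by (rule ForallD[OF EA_sentences])
qed

lemma EA_cases:
  assumes "Delta0 A" and "proves EA (inst A Zr)" and "proves EA (inst_Sc A)"
  shows "proves EA A"
  using EA_induct[OF assms(1,2)] mp[OF axK assms(3)] by blast

lemma EA_LeqI: "proves EA (Imp (Eqt (Pl u t) s) (Leq t s))"
  by (rule taut_conseq2[OF EA_Leq_iff_Exists[of t s]
        ExistsI[of _ "Eqt (Pl (Var 0) (liftT 0 t)) (liftT 0 s)" u]]) auto

lemma EA_LeqE: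
  assumes "proves EA (Imp (Eqt (Pl (Var 0) (liftT 0 t)) (liftT 0 s)) (liftF 0 C))"
  shows "proves EA (Imp (Leq t s) C)"
  by (rule taut_conseq2[OF EA_Leq_iff_Exists[of t s] ExistsE[OF assms]]) auto

lemma EA_Zr_Leq: "proves EA (Leq Zr t)"
  by (rule mp[OF EA_LeqI EA_Pl_Zr])

lemma EA_Pl_Sc_eq_iff: "proves EA (Iff (Eqt (Pl u (Sc t)) (Sc s)) (Eqt (Pl u t) s))"
  by (rule taut_conseq3[OF Eqt_cong[OF EA_Pl_Sc[of u t] axRefl[of _ "Sc s"]]
        EA_Sc_inj[of "Pl u t" s] eq_Sc[of _ "Pl u t" s]]) auto

lemma EA_Leq_Sc_Sc: "proves EA (Iff (Leq (Sc t) (Sc s)) (Leq t s))"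
proof -
  have "proves EA (Imp (Leq (Sc t) (Sc s)) (Leq t s))"
    by (rule EA_LeqE, rule taut_conseq2[OF EA_Pl_Sc_eq_iff[of "Var 0" "liftT 0 t" "liftT 0 s"]
          EA_LeqI[of "Var 0" "liftT 0 t" "liftT 0 s"]]) (auto simp: liftF_0 liftT_0)
  moreover have "proves EA (Imp (Leq t s) (Leq (Sc t) (Sc s)))"
    by (rule EA_LeqE, rule taut_conseq2[OF EA_Pl_Sc_eq_iff[of "Var 0" "liftT 0 t" "liftT 0 s"]
          EA_LeqI[of "Var 0" "Sc (liftT 0 t)" "Sc (liftT 0 s)"]]) (auto simp: liftF_0 liftT_0)
  ultimately show ?thesis by (rule taut_conseq2) auto
qed

lemma EA_not_Sc_Leq_Zr: "proves EA (Neg (Leq (Sc t) Zr))"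
  unfolding Neg_def
proof (rule EA_LeqE)
  show "proves EA (Imp (Eqt (Pl (Var 0) (liftT 0 (Sc t))) (liftT 0 Zr)) (liftF 0 Fls))"
    by (rule taut_conseq2[OF Eqt_cong[OF EA_Pl_Sc[of "Var 0" "liftT 0 t"] axRefl[of _ Zr]]
          EA_Sc_neq_Zr[of "Pl (Var 0) (liftT 0 t)"]]) simp
qed

lemma EA_Leq_num_linear_Var: "proves EA (Disj (Leq (Var 0) (num n)) (Leq (num n) (Var 0)))"
proof (induction n)
  case 0
  show ?case by (rule taut_conseq1[OF EA_Zr_Leq[of "Var 0"]]) simp
next
  case (Suc n)
  show ?case
  proof (rule EA_cases)
    show "proves EA (inst (Disj (Leq (Var 0) (num (Suc n))) (Leq (num (Suc n)) (Var 0))) Zr)"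
      by (rule taut_conseq1[OF EA_Zr_Leq[of "num (Suc n)"]]) simp
    show "proves EA (inst_Sc (Disj (Leq (Var 0) (num (Suc n))) (Leq (num (Suc n)) (Var 0))))"
      by (rule taut_conseq3[OF Suc EA_Leq_Sc_Sc[of "Var 0" "num n"]
            EA_Leq_Sc_Sc[of "num n" "Var 0"]]) auto
  qed (auto intro: Delta0.intros)
qed

lemma EA_Leq_num_linear: "proves EA (Disj (Leq t (num n)) (Leq (num n) t))"
  using EA_psubF[OF EA_Leq_num_linear_Var[of n], of "case_nat t Var"] by simp

lemma EA_Sc_Pl: "proves EA (Eqt (Pl (Sc t) s) (Sc (Pl t s)))"
proof -
  have "proves EA (Eqt (Pl (Sc (Var 1)) (Var 0)) (Sc (Pl (Var 1) (Var 0))))" (is "proves EA ?A")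
  proof (rule EA_induct)
    have "proves EA (Eqt (Pl (Sc (Var 0)) Zr) (Sc (Var 0)))"
      by (rule EA_Pl_Zr)
    also have "proves EA (Eqt (Sc (Var 0)) (Sc (Pl (Var 0) Zr)))"
      by (rule eq_ScD[OF eq_symD[OF EA_Pl_Zr]])
    finally show "proves EA (inst ?A Zr)" by simp
    have "proves EA (Iff (Eqt (Pl (Sc (Var 1)) (Sc (Var 0))) (Sc (Pl (Var 1) (Sc (Var 0)))))
        (Eqt (Sc (Pl (Sc (Var 1)) (Var 0))) (Sc (Sc (Pl (Var 1) (Var 0))))))"
      by (rule Eqt_cong[OF EA_Pl_Sc eq_ScD[OF EA_Pl_Sc]])
    from taut_conseq2[OF this eq_Sc[of EA "Pl (Sc (Var 1)) (Var 0)" "Sc (Pl (Var 1) (Var 0))"]]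
    show "proves EA (Imp ?A (inst_Sc ?A))" by simp
  qed (rule Delta0.intros)
  from EA_psubF[OF this, of "case_nat s (case_nat t Var)"] show ?thesis by simp
qed

lemma EA_Zr_Pl: "proves EA (Eqt (Pl Zr t) t)"
proof -
  have "proves EA (Eqt (Pl Zr (Var 0)) (Var 0))" (is "proves EA ?A")
  proof (rule EA_induct)
    show "proves EA (inst ?A Zr)" using EA_Pl_Zr by simp
    show "proves EA (Imp ?A (inst_Sc ?A))"
      by (rule taut_conseq1[OF EA_Pl_Sc_eq_iff[of Zr "Var 0" "Var 0"]]) simp
  qed (rule Delta0.intros)
  from EA_psubF[OF this, of "case_nat t Var"] show ?thesis by simp
qed

lemma EA_Leq_ScD: "proves EA (Imp (Leq (Sc t) s) (Leq t s))"
proof (rule EA_LeqE)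
  have "proves EA (Eqt (Pl (Var 0) (Sc (liftT 0 t))) (Pl (Sc (Var 0)) (liftT 0 t)))"
    by (rule eq_transD[OF EA_Pl_Sc eq_symD[OF EA_Sc_Pl]])
  from taut_conseq2[OF Eqt_cong[OF this axRefl[of _ "liftT 0 s"]]
      EA_LeqI[of "Sc (Var 0)" "liftT 0 t" "liftT 0 s"]]
  show "proves EA (Imp (Eqt (Pl (Var 0) (liftT 0 (Sc t))) (liftT 0 s)) (liftF 0 (Leq t s)))"
    by simp
qed

lemma EA_Leq_ScE: "proves EA (Imp (Leq t (Sc s)) (Disj (Leq t s) (Eqt t (Sc s))))"
proof (rule EA_LeqE, rule EA_cases)
  let ?A = "Imp (Eqt (Pl (Var 0) (liftT 0 t)) (liftT 0 (Sc s)))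
      (liftF 0 (Disj (Leq t s) (Eqt t (Sc s))))"
  show "Delta0 ?A" by (auto simp: Disj_def Neg_def intro: Delta0.intros)
  show "proves EA (inst ?A Zr)"
    by (rule taut_conseq1[OF Eqt_cong[OF EA_Zr_Pl[of t] axRefl[of _ "Sc s"]]]) simp
  let ?t = "liftT 0 t" and ?s = "liftT 0 s"
  have "proves EA (Imp (Eqt (Pl (Sc (Var 0)) ?t) (Sc ?s)) (Leq ?t ?s))"
    by (rule taut_conseq3[OF Eqt_cong[OF EA_Sc_Pl[of "Var 0" ?t] axRefl[of _ "Sc ?s"]]
          EA_Sc_inj[of "Pl (Var 0) ?t" ?s] EA_LeqI[of "Var 0" ?t ?s]]) simp
  then show "proves EA (inst_Sc ?A)"
    by (rule taut_conseq1) (simp flip: liftT_0)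
qed

lemma EA_Leq_ZrE: "proves EA (Imp (Leq t Zr) (Eqt t Zr))"
proof -
  have "proves EA (Imp (Leq (Var 0) Zr) (Eqt (Var 0) Zr))"
  proof (rule EA_cases)
    show "proves EA (inst (Imp (Leq (Var 0) Zr) (Eqt (Var 0) Zr)) Zr)"
      by (rule taut_conseq1[OF axRefl[of _ Zr]]) simp
    show "proves EA (inst_Sc (Imp (Leq (Var 0) Zr) (Eqt (Var 0) Zr)))"
      by (rule taut_conseq1[OF EA_not_Sc_Leq_Zr[of "Var 0"]]) simp
  qed (auto intro: Delta0.intros)
  from EA_psubF[OF this, of "case_nat t Var"] show ?thesis by simp
qed

lemma EA_Leq_num_mono: "m \<le> n \<Longrightarrow> proves EA (Imp (Leq (num n) t) (Leq (num m) t))"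
proof (induction n rule: dec_induct)
  case base
  show ?case by (rule taut) simp
next
  case (step n)
  show ?case by (rule taut_conseq2[OF step.IH EA_Leq_ScD[of "num n" t]]) simp
qed

lemma EA_BAll_numI:
  assumes "\<And>m. m \<le> n \<Longrightarrow> proves EA (inst A (num m))"
  shows "proves EA (BAll (num n) A)"
proof -
  have A_if_eq: "proves EA (Imp (Eqt (Var 0) (num m)) A)" if "m \<le> n" for m
  proof -
    have "proves EA (psubF (case_nat (num m) (\<lambda>i. Var (Suc i))) A)"
      using EA_psubF[OF assms[OF that], of "\<lambda>i. Var (Suc i)"] by simp
    moreover have "proves EA (Imp (Eqt (num m) (Var 0))
        (Imp (psubF (case_nat (num m) (\<lambda>i. Var (Suc i))) A) A))"
      using eq_subst[of EA "num m" "Var 0" "\<lambda>i. Var (Suc i)" A] by simp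
    ultimately show ?thesis
      by (rule taut_conseq3[OF _ _ eq_sym[of _ "Var 0" "num m"]]) simp
  qed
  have "m \<le> n \<Longrightarrow> proves EA (Imp (Leq (Var 0) (num m)) A)" for m
  proof (induction m)
    case 0
    show ?case by (rule taut_conseq2[OF EA_Leq_ZrE[of "Var 0"] A_if_eq[of 0]]) auto
  next
    case (Suc m)
    then have "m \<le> n" by simp
    then show ?case
      by (rule taut_conseq3[OF Suc.IH EA_Leq_ScE[of "Var 0" "num m"] A_if_eq[OF Suc.prems]]) auto
  qed
  then have "proves EA (Imp (Leq (Var 0) (num n)) A)" by simp
  then show ?thesis unfolding BAll_def liftT_num by (rule gen)
qed

lemma EA_cases_num:
  assumes "proves EA (BAll (num n) A)" and "proves EA (Imp (Leq (num n) (Var 0)) A)"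
  shows "proves EA A"
proof -
  have "proves EA (Imp (Leq (Var 0) (num n)) A)"
    using assms(1) unfolding BAll_def liftT_num by (rule ForallD[OF EA_sentences])
  then show ?thesis by (rule taut_conseq3[OF _ assms(2) EA_Leq_num_linear[of "Var 0" n]]) auto
qed

section \<open>Decidability of bounded formulas in EA\<close>

lemma EA_num_Pl: "proves EA (Eqt (Pl (num m) (num n)) (num (m + n)))"
proof (induction n)
  case (Suc n)
  show ?case using eq_transD[OF EA_Pl_Sc eq_ScD[OF Suc]] by simp
qed (simp add: EA_Pl_Zr)

lemma EA_num_Tm: "proves EA (Eqt (Tm (num m) (num n)) (num (m * n)))"
proof (induction n)
  case (Suc n)
  have "proves EA (Eqt (Tm (num m) (Sc (num n))) (Pl (Tm (num m) (num n)) (num m)))"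
    by (rule EA_Tm_Sc)
  also have "proves EA (Eqt (Pl (Tm (num m) (num n)) (num m)) (Pl (num (m * n)) (num m)))"
    by (rule eq_PlD[OF Suc axRefl])
  also have "proves EA (Eqt (Pl (num (m * n)) (num m)) (num (m * n + m)))"
    by (rule EA_num_Pl)
  finally show ?case by (simp add: add.commute)
qed (simp add: EA_Tm_Zr)

lemma EA_num_Ex2: "proves EA (Eqt (Ex2 (num n)) (num (2 ^ n)))"
proof (induction n)
  case (Suc n)
  have "proves EA (Eqt (Ex2 (Sc (num n))) (Pl (Ex2 (num n)) (Ex2 (num n))))"
    by (rule EA_Ex2_Sc)
  also have "proves EA (Eqt (Pl (Ex2 (num n)) (Ex2 (num n))) (Pl (num (2 ^ n)) (num (2 ^ n))))"
    by (rule eq_PlD[OF Suc Suc])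
  also have "proves EA (Eqt (Pl (num (2 ^ n)) (num (2 ^ n))) (num (2 ^ n + 2 ^ n)))"
    by (rule EA_num_Pl)
  finally show ?case by (simp add: mult_2)
qed (simp add: EA_Ex2_Zr)

lemma EA_eval_term: "proves EA (Eqt (psubT (\<lambda>i. num (e i)) t) (num (evalT e t)))"
proof (induction t)
  case (Pl t s)
  then show ?case using eq_transD[OF eq_PlD EA_num_Pl] by simp
next
  case (Tm t s)
  then show ?case using eq_transD[OF eq_TmD EA_num_Tm] by simp
next
  case (Ex2 t)
  then show ?case using eq_transD[OF eq_Ex2D EA_num_Ex2] by simp
qed (simp_all add: axRefl eq_ScD)

definition decides :: "fm set \<Rightarrow> fm \<Rightarrow> bool \<Rightarrow> bool" where
  "decides T A b \<longleftrightarrow> proves T (if b then A else Neg A)"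

lemma decides_cong: "decides T A b \<Longrightarrow> proves T (Iff A B) \<Longrightarrow> decides T B b"
  unfolding decides_def by (erule (1) taut_conseq2) (cases b; simp)

lemma decides_Fls: "decides T Fls False"
  unfolding decides_def by (rule taut) simp

lemma decides_Imp: "decides T A a \<Longrightarrow> decides T B b \<Longrightarrow> decides T (Imp A B) (a \<longrightarrow> b)"
  unfolding decides_def by (erule (1) taut_conseq2) (cases a; cases b; simp)

lemma EA_decides_Eqt_num: "decides EA (Eqt (num m) (num n)) (m = n)"
proof (induction m n rule: diff_induct)
  case (1 m)
  show ?case
    using EA_Sc_neq_Zr axRefl by (cases m) (auto simp: decides_def)
next
  case (2 n)
  show ?case
    using taut_conseq2[OF EA_Sc_neq_Zr[of "num n"] eq_sym[of _ Zr "Sc (num n)"]]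
    by (simp add: decides_def)
next
  case (3 m n)
  have "proves EA (Iff (Eqt (num m) (num n)) (Eqt (Sc (num m)) (Sc (num n))))"
    by (rule taut_conseq2[OF EA_Sc_inj[of "num m" "num n"] eq_Sc[of _ "num m" "num n"]]) auto
  from decides_cong[OF 3 this] show ?case by simp
qed

lemma EA_decides_Leq_num: "decides EA (Leq (num m) (num n)) (m \<le> n)"
proof (induction m n rule: diff_induct)
  case (1 m)
  show ?case
    using EA_Zr_Leq EA_not_Sc_Leq_Zr by (cases m) (auto simp: decides_def)
next
  case (2 n)
  show ?case using EA_Zr_Leq by (simp add: decides_def)
next
  case (3 m n)
  have "proves EA (Iff (Leq (num m) (num n)) (Leq (Sc (num m)) (Sc (num n))))"
    by (rule taut_conseq1[OF EA_Leq_Sc_Sc[of "num m" "num n"]]) auto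
  from decides_cong[OF 3 this] show ?case by simp
qed

lemma EA_decides_BAll_num:
  assumes "\<And>m. m \<le> n \<Longrightarrow> decides EA (inst A (num m)) (P m)"
  shows "decides EA (BAll (num n) A) (\<forall>m \<le> n. P m)"
proof (cases "\<forall>m \<le> n. P m")
  case True
  then have "proves EA (BAll (num n) A)"
    using assms by (intro EA_BAll_numI) (simp add: decides_def)
  then show ?thesis using True by (simp add: decides_def)
next
  case False
  then obtain m where "m \<le> n" "\<not> P m" by blast
  then have "proves EA (Neg (inst A (num m)))" and "proves EA (Leq (num m) (num n))"
    using assms[of m] EA_decides_Leq_num[of m n] by (auto simp: decides_def)
  then have "proves EA (Neg (BAll (num n) A))"
    by (rule taut_conseq3[OF _ _ BAllE[of _ Var "num n" A "num m"]]) simp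
  then show ?thesis using False by (auto simp: decides_def)
qed

theorem EA_decides_Delta0:
  assumes "Delta0 A"
  shows "decides EA (psubF (\<lambda>i. num (e i)) A) (evalF e A)"
  using assms
proof (induction A arbitrary: e rule: Delta0.induct)
  case 1
  show ?case by (simp add: decides_Fls)
next
  case (2 t s)
  show ?case
    using decides_cong[OF EA_decides_Eqt_num
        Eqt_cong[OF eq_symD[OF EA_eval_term] eq_symD[OF EA_eval_term]]] by simp
next
  case (3 t s)
  show ?case
    using decides_cong[OF EA_decides_Leq_num
        Leq_cong[OF eq_symD[OF EA_eval_term] eq_symD[OF EA_eval_term]]] by simp
next
  case (4 A B)
  then show ?case by (simp add: decides_Imp)
next
  case (5 A t)
  let ?\<sigma> = "\<lambda>i. num (e i)" and ?b = "\<forall>m \<le> evalT e t. evalF (case_nat m e) A"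
  have "decides EA (inst (psubF (up ?\<sigma>) A) (num m)) (evalF (case_nat m e) A)" for m
  proof -
    have "case_nat (num m) ?\<sigma> = (\<lambda>i. num (case_nat m e i))" by (auto split: nat.splits)
    then show ?thesis using 5(2)[of "case_nat m e"] by simp
  qed
  then have "decides EA (BAll (num (evalT e t)) (psubF (up ?\<sigma>) A)) ?b"
    by (rule EA_decides_BAll_num)
  then have "decides EA (BAll (psubT ?\<sigma> t) (psubF (up ?\<sigma>) A)) ?b"
    by (rule decides_cong[OF _ BAll_bound_cong[OF eq_symD[OF EA_eval_term]]])
  then show ?case using evalF_BAll[of e t A] psubF_BAll[of ?\<sigma> t A] by (simp add: BAll_def)
qed

lemma EA_Delta0_true: "Delta0 A \<Longrightarrow> evalF (env xs) A \<Longrightarrow> proves EA (ap A (map num xs))"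
  using EA_decides_Delta0[of A "env xs"] by (simp add: args_map_num decides_def)

lemma EA_Delta0_false: "Delta0 A \<Longrightarrow> \<not> evalF (env xs) A \<Longrightarrow> proves EA (Neg (ap A (map num xs)))"
  using EA_decides_Delta0[of A "env xs"] by (simp add: args_map_num decides_def)

section \<open>Sigma-1 predicates of the standard model\<close>

abbreviation (input) tail :: "(nat \<Rightarrow> 'a) \<Rightarrow> nat \<Rightarrow> 'a" where
  "tail e \<equiv> \<lambda>i. e (Suc i)"

definition term_fun :: "((nat \<Rightarrow> nat) \<Rightarrow> nat) \<Rightarrow> bool" where
  "term_fun f \<longleftrightarrow> (\<exists>t. \<forall>e. evalT e t = f e)"

definition delta0_pred :: "((nat \<Rightarrow> nat) \<Rightarrow> bool) \<Rightarrow> bool" where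
  "delta0_pred P \<longleftrightarrow> (\<exists>A. Delta0 A \<and> (\<forall>e. evalF e A = P e))"

definition sigma1_pred :: "((nat \<Rightarrow> nat) \<Rightarrow> bool) \<Rightarrow> bool" where
  "sigma1_pred P \<longleftrightarrow> (\<exists>Q. delta0_pred Q \<and> (\<forall>e. P e \<longleftrightarrow> (\<exists>w. Q (case_nat w e))))"

definition sigma1_fun :: "((nat \<Rightarrow> nat) \<Rightarrow> nat) \<Rightarrow> bool" where
  "sigma1_fun f \<longleftrightarrow> sigma1_pred (\<lambda>e. e 0 = f (tail e))"

lemma term_fun_Var: "term_fun (\<lambda>e. e i)"
  unfolding term_fun_def by (rule exI[of _ "Var i"]) simp

lemma term_fun_const: "term_fun (\<lambda>e. n)"
  unfolding term_fun_def by (rule exI[of _ "num n"]) simp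

lemma term_fun_Suc: "term_fun f \<Longrightarrow> term_fun (\<lambda>e. Suc (f e))"
  unfolding term_fun_def by (metis evalT.simps(3))

lemma term_fun_add: "term_fun f \<Longrightarrow> term_fun g \<Longrightarrow> term_fun (\<lambda>e. f e + g e)"
  unfolding term_fun_def by (metis evalT.simps(4))

lemma term_fun_mult: "term_fun f \<Longrightarrow> term_fun g \<Longrightarrow> term_fun (\<lambda>e. f e * g e)"
  unfolding term_fun_def by (metis evalT.simps(5))

lemmas term_fun_intros = term_fun_Var term_fun_const term_fun_Suc term_fun_add term_fun_mult

lemma term_fun_env:
  assumes "\<And>i. term_fun (\<lambda>e. s e i)"
  obtains \<sigma> where "\<And>e. (\<lambda>i. evalT e (\<sigma> i)) = s e"
proof -
  have "\<forall>i. \<exists>t. \<forall>e. evalT e t = s e i" using assms unfolding term_fun_def by blast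
  then obtain \<sigma> where "\<forall>i e. evalT e (\<sigma> i) = s e i" by metis
  then show ?thesis using that[of \<sigma>] by auto
qed

lemma term_fun_subst: "term_fun f \<Longrightarrow> (\<And>i. term_fun (\<lambda>e. s e i)) \<Longrightarrow> term_fun (\<lambda>e. f (s e))"
  using term_fun_env[of s] unfolding term_fun_def by (metis evalT_psubT)

lemma term_fun_tail: "term_fun f \<Longrightarrow> term_fun (\<lambda>e. f (tail e))"
  by (rule term_fun_subst) (auto intro: term_fun_Var)

lemma term_fun_case_nat:
  "term_fun f \<Longrightarrow> (\<And>i. term_fun (\<lambda>e. s e i)) \<Longrightarrow> term_fun (\<lambda>e. case_nat (f e) (s e) i)"
  by (cases i) auto

lemma delta0_subst: "delta0_pred P \<Longrightarrow> (\<And>i. term_fun (\<lambda>e. s e i)) \<Longrightarrow> delta0_pred (\<lambda>e. P (s e))"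
  using term_fun_env[of s] unfolding delta0_pred_def by (metis evalF_psubF Delta0_psubF)

lemma delta0_eq: "term_fun f \<Longrightarrow> term_fun g \<Longrightarrow> delta0_pred (\<lambda>e. f e = g e)"
  unfolding delta0_pred_def term_fun_def by (metis evalF.simps(2) Delta0.intros(2))

lemma delta0_le: "term_fun f \<Longrightarrow> term_fun g \<Longrightarrow> delta0_pred (\<lambda>e. f e \<le> g e)"
  unfolding delta0_pred_def term_fun_def by (metis evalF.simps(3) Delta0.intros(3))

lemma delta0_less: "term_fun f \<Longrightarrow> term_fun g \<Longrightarrow> delta0_pred (\<lambda>e. f e < g e)"
  using delta0_le[of "\<lambda>e. Suc (f e)" g] term_fun_Suc[of f] by (simp add: Suc_le_eq)

lemma delta0_not: "delta0_pred P \<Longrightarrow> delta0_pred (\<lambda>e. \<not> P e)"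
  unfolding delta0_pred_def by (metis evalF_Neg Delta0_Neg)

lemma delta0_conj: "delta0_pred P \<Longrightarrow> delta0_pred Q \<Longrightarrow> delta0_pred (\<lambda>e. P e \<and> Q e)"
  unfolding delta0_pred_def by (metis evalF_Conj Delta0_Conj)

lemma delta0_disj: "delta0_pred P \<Longrightarrow> delta0_pred Q \<Longrightarrow> delta0_pred (\<lambda>e. P e \<or> Q e)"
  unfolding delta0_pred_def by (metis evalF_Disj Delta0_Disj)

lemma delta0_ball:
  assumes "delta0_pred (\<lambda>e. P (e 0) (tail e))" and "term_fun f"
  shows "delta0_pred (\<lambda>e. \<forall>x \<le> f e. P x e)"
proof -
  obtain A t where "Delta0 A" "\<And>e. evalF e A = P (e 0) (tail e)" "\<And>e. evalT e t = f e"
    using assms unfolding delta0_pred_def term_fun_def by blast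
  then show ?thesis unfolding delta0_pred_def by (intro exI[of _ "BAll t A"]) auto
qed

lemma delta0_bex:
  assumes "delta0_pred (\<lambda>e. P (e 0) (tail e))" and "term_fun f"
  shows "delta0_pred (\<lambda>e. \<exists>x \<le> f e. P x e)"
  using delta0_not[OF delta0_ball[OF delta0_not[OF assms(1)] assms(2)]] by simp

lemma sigma1_subst:
  assumes "sigma1_pred P" and s: "\<And>i. term_fun (\<lambda>e. s e i)"
  shows "sigma1_pred (\<lambda>e. P (s e))"
proof -
  obtain Q where Q: "delta0_pred Q" "\<And>e. P e \<longleftrightarrow> (\<exists>w. Q (case_nat w e))"
    using assms(1) unfolding sigma1_pred_def by blast
  have "delta0_pred (\<lambda>e. Q (case_nat (e 0) (s (tail e))))"
    by (rule delta0_subst[OF Q(1)]) (intro term_fun_case_nat term_fun_Var term_fun_tail s)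
  then show ?thesis unfolding sigma1_pred_def using Q(2)
    by (intro exI[of _ "\<lambda>e. Q (case_nat (e 0) (s (tail e)))"]) simp
qed

lemma delta0_imp_sigma1:
  assumes "delta0_pred P"
  shows "sigma1_pred P"
proof -
  have "delta0_pred (\<lambda>e. P (tail e))"
    by (rule delta0_subst[OF assms]) (rule term_fun_Var)
  then show ?thesis unfolding sigma1_pred_def by (intro exI[of _ "\<lambda>e. P (tail e)"]) simp
qed

lemma sigma1_disj:
  assumes "sigma1_pred P" and "sigma1_pred Q"
  shows "sigma1_pred (\<lambda>e. P e \<or> Q e)"
proof -
  obtain P' Q' where "delta0_pred P'" "\<And>e. P e \<longleftrightarrow> (\<exists>w. P' (case_nat w e))"
    "delta0_pred Q'" "\<And>e. Q e \<longleftrightarrow> (\<exists>w. Q' (case_nat w e))"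
    using assms unfolding sigma1_pred_def by blast
  then show ?thesis unfolding sigma1_pred_def
    by (intro exI[of _ "\<lambda>e. P' e \<or> Q' e"]) (auto intro: delta0_disj)
qed

lemma sigma1_conj:
  assumes "sigma1_pred P" and "sigma1_pred Q"
  shows "sigma1_pred (\<lambda>e. P e \<and> Q e)"
proof -
  obtain P' Q' where P: "delta0_pred P'" "\<And>e. P e \<longleftrightarrow> (\<exists>w. P' (case_nat w e))"
    and Q: "delta0_pred Q'" "\<And>e. Q e \<longleftrightarrow> (\<exists>w. Q' (case_nat w e))"
    using assms unfolding sigma1_pred_def by blast
  let ?R = "\<lambda>e. (\<exists>w \<le> e 0. P' (case_nat w (tail e))) \<and> (\<exists>w \<le> e 0. Q' (case_nat w (tail e)))"
  have "delta0_pred ?R"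
    by (intro delta0_conj delta0_bex delta0_subst[OF P(1)] delta0_subst[OF Q(1)]
        term_fun_case_nat term_fun_Var)
  moreover have "P e \<and> Q e \<longleftrightarrow> (\<exists>w. ?R (case_nat w e))" for e
    unfolding P(2) Q(2) by simp (meson nat_le_linear)
  ultimately show ?thesis unfolding sigma1_pred_def by blast
qed

lemma sigma1_ex:
  assumes "sigma1_pred (\<lambda>e. P (e 0) (tail e))"
  shows "sigma1_pred (\<lambda>e. \<exists>x. P x e)"
proof -
  obtain Q where Q: "delta0_pred Q" "\<And>e. P (e 0) (tail e) \<longleftrightarrow> (\<exists>w. Q (case_nat w e))"
    using assms unfolding sigma1_pred_def by blast
  let ?R = "\<lambda>e. \<exists>x \<le> e 0. \<exists>w \<le> e 0. Q (case_nat w (case_nat x (tail e)))"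
  have "delta0_pred ?R"
    by (intro delta0_bex delta0_subst[OF Q(1)] term_fun_case_nat term_fun_Var)
  moreover have "(\<exists>x. P x e) \<longleftrightarrow> (\<exists>w. ?R (case_nat w e))" for e
    using Q(2)[of "case_nat _ e"] by simp (meson nat_le_linear)
  ultimately show ?thesis unfolding sigma1_pred_def by blast
qed

lemma bounded_collection:
  assumes "\<forall>x \<le> n. \<exists>w. Q x w"
  shows "\<exists>b::nat. \<forall>x \<le> (n::nat). \<exists>w \<le> b. Q x w"
proof -
  obtain h where h: "\<And>x. x \<le> n \<Longrightarrow> Q x (h x)" using assms by metis
  have "h x \<le> Max (h ` {..n})" if "x \<le> n" for x
    using that by (intro Max_ge) auto
  then show ?thesis using h by blast
qed

lemma sigma1_ball:
  assumes "sigma1_pred (\<lambda>e. P (e 0) (tail e))" and "term_fun f"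
  shows "sigma1_pred (\<lambda>e. \<forall>x \<le> f e. P x e)"
proof -
  obtain Q where Q: "delta0_pred Q" "\<And>e. P (e 0) (tail e) \<longleftrightarrow> (\<exists>w. Q (case_nat w e))"
    using assms unfolding sigma1_pred_def by blast
  let ?R = "\<lambda>e. \<forall>x \<le> f (tail e). \<exists>w \<le> e 0. Q (case_nat w (case_nat x (tail e)))"
  have "delta0_pred ?R"
    by (intro delta0_bex delta0_ball delta0_subst[OF Q(1)] term_fun_case_nat term_fun_Var
        term_fun_tail assms(2))
  moreover have "(\<forall>x \<le> f e. P x e) \<longleftrightarrow> (\<exists>w. ?R (case_nat w e))" for e
    using Q(2)[of "case_nat _ e"]
      bounded_collection[of "f e" "\<lambda>x w. Q (case_nat w (case_nat x e))"] by auto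
  ultimately show ?thesis unfolding sigma1_pred_def by blast
qed

lemma sigma1_evalF: "Sigma1 A \<Longrightarrow> sigma1_pred (\<lambda>e. evalF e A)"
proof (induction rule: Sigma1.induct)
  case (1 A)
  then show ?case by (intro delta0_imp_sigma1) (auto simp: delta0_pred_def)
next
  case (2 A)
  have "case_nat (e 0) (tail e) = e" for e :: "nat \<Rightarrow> nat"
    by (auto split: nat.splits)
  then have "sigma1_pred (\<lambda>e. \<exists>n. evalF (case_nat n e) A)"
    using 2 by (intro sigma1_ex) simp
  then show ?case by simp
qed

lemma term_imp_sigma1_fun: "term_fun f \<Longrightarrow> sigma1_fun f"
  unfolding sigma1_fun_def by (intro delta0_imp_sigma1 delta0_eq term_fun_Var term_fun_tail)

lemma sigma1_fun_Var: "sigma1_fun (\<lambda>e. e i)"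
  and sigma1_fun_const: "sigma1_fun (\<lambda>e. n)"
  by (intro term_imp_sigma1_fun term_fun_intros)+

lemma sigma1_fun_tail: "sigma1_fun f \<Longrightarrow> sigma1_fun (\<lambda>e. f (tail e))"
  unfolding sigma1_fun_def
  using sigma1_subst[of "\<lambda>e. e 0 = f (tail e)" "\<lambda>e. case_nat (e 0) (tail (tail e))"]
    term_fun_case_nat[of "\<lambda>e. e 0" "\<lambda>e. tail (tail e)"] by (simp add: term_fun_Var)

lemma sigma1_fun_subst:
  assumes "sigma1_pred (\<lambda>e. P (e 0) (tail e))" and "sigma1_fun f"
  shows "sigma1_pred (\<lambda>e. P (f e) e)"
proof -
  have "sigma1_pred (\<lambda>e. \<exists>y. y = f e \<and> P y e)"
    by (intro sigma1_ex sigma1_conj assms(1) assms(2)[unfolded sigma1_fun_def])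
  then show ?thesis by simp
qed

definition ce1 :: "(nat \<Rightarrow> bool) \<Rightarrow> bool" where
  "ce1 R \<longleftrightarrow> sigma1_pred (\<lambda>e. R (e 0))"

definition ce2 :: "(nat \<Rightarrow> nat \<Rightarrow> bool) \<Rightarrow> bool" where
  "ce2 R \<longleftrightarrow> sigma1_pred (\<lambda>e. R (e 0) (e 1))"

definition ce3 :: "(nat \<Rightarrow> nat \<Rightarrow> nat \<Rightarrow> bool) \<Rightarrow> bool" where
  "ce3 R \<longleftrightarrow> sigma1_pred (\<lambda>e. R (e 0) (e 1) (e 2))"

lemma ce1_app: "ce1 R \<Longrightarrow> sigma1_fun f \<Longrightarrow> sigma1_pred (\<lambda>e. R (f e))"
  unfolding ce1_def by (rule sigma1_fun_subst)

lemma ce2_app: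
  assumes "ce2 R" "sigma1_fun f" "sigma1_fun g"
  shows "sigma1_pred (\<lambda>e. R (f e) (g e))"
proof (rule sigma1_fun_subst[OF _ assms(2)],
    rule sigma1_fun_subst[OF _ sigma1_fun_tail[OF assms(3)]])
  show "sigma1_pred (\<lambda>e. R (e (Suc 0)) (e 0))"
    using sigma1_subst[OF assms(1)[unfolded ce2_def], of "\<lambda>e. case_nat (e 1) (\<lambda>_. e 0)"]
      term_fun_case_nat[of "\<lambda>e. e 1" "\<lambda>e i. e 0"] by (simp add: term_fun_Var)
qed

lemma ce3_app:
  assumes "ce3 R" "sigma1_fun f" "sigma1_fun g" "sigma1_fun h"
  shows "sigma1_pred (\<lambda>e. R (f e) (g e) (h e))"
proof (rule sigma1_fun_subst[OF _ assms(2)],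
    rule sigma1_fun_subst[OF _ sigma1_fun_tail[OF assms(3)]],
    rule sigma1_fun_subst[OF _ sigma1_fun_tail[OF sigma1_fun_tail[OF assms(4)]]])
  show "sigma1_pred (\<lambda>e. R (e (Suc (Suc 0))) (e (Suc 0)) (e 0))"
    using sigma1_subst[OF assms(1)[unfolded ce3_def],
        of "\<lambda>e. case_nat (e 2) (case_nat (e 1) (\<lambda>_. e 0))"]
      term_fun_case_nat[of "\<lambda>e. e 2" "\<lambda>e. case_nat (e 1) (\<lambda>_. e 0)"]
      term_fun_case_nat[of "\<lambda>e. e 1" "\<lambda>e i. e 0"] by (simp add: term_fun_Var numeral_2_eq_2)
qed

lemma sigma1_fun_comp1: "ce2 (\<lambda>y x. y = h x) \<Longrightarrow> sigma1_fun f \<Longrightarrow> sigma1_fun (\<lambda>e. h (f e))"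
  using ce2_app[of "\<lambda>y x. y = h x" "\<lambda>e. e 0" "\<lambda>e. f (tail e)"]
  by (simp add: sigma1_fun_def[of "\<lambda>e. h (f e)"] sigma1_fun_Var sigma1_fun_tail)

lemma sigma1_fun_comp2:
  "ce3 (\<lambda>z x y. z = h x y) \<Longrightarrow> sigma1_fun f \<Longrightarrow> sigma1_fun g \<Longrightarrow> sigma1_fun (\<lambda>e. h (f e) (g e))"
  using ce3_app[of "\<lambda>z x y. z = h x y" "\<lambda>e. e 0" "\<lambda>e. f (tail e)" "\<lambda>e. g (tail e)"]
  by (simp add: sigma1_fun_def[of "\<lambda>e. h (f e) (g e)"] sigma1_fun_Var sigma1_fun_tail)

lemma sigma1_fun_Suc: "sigma1_fun f \<Longrightarrow> sigma1_fun (\<lambda>e. Suc (f e))"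
  by (rule sigma1_fun_comp1) (simp_all add: ce2_def delta0_imp_sigma1 delta0_eq term_fun_intros)

lemma double_prod_encode: "2 * prod_encode (x, y) = (x + y) * Suc (x + y) + 2 * x"
proof -
  have "2 * triangle n = n * Suc n" for n unfolding triangle_def by simp
  then show ?thesis unfolding prod_encode_def prod.case by (simp only: distrib_left)
qed

lemma ce3_prod_encode: "ce3 (\<lambda>z x y. z = prod_encode (x, y))"
proof -
  have "z = prod_encode (x, y) \<longleftrightarrow> 2 * z = (x + y) * Suc (x + y) + 2 * x" for x y z
    unfolding double_prod_encode[symmetric] by simp
  then show ?thesis unfolding ce3_def
    by (simp only:) (intro delta0_imp_sigma1 delta0_eq term_fun_intros)
qed

lemmas sigma1_fun_prod_encode = sigma1_fun_comp2[OF ce3_prod_encode]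

lemma sigma1_eq: "sigma1_fun f \<Longrightarrow> sigma1_fun g \<Longrightarrow> sigma1_pred (\<lambda>e. f e = g e)"
  by (rule ce2_app[of "(=)"])
    (auto simp: ce2_def intro!: delta0_imp_sigma1 delta0_eq term_fun_intros)

lemma sigma1_less: "sigma1_fun f \<Longrightarrow> sigma1_fun g \<Longrightarrow> sigma1_pred (\<lambda>e. f e < g e)"
  by (rule ce2_app[of "(<)"])
    (auto simp: ce2_def intro!: delta0_imp_sigma1 delta0_less term_fun_intros)

lemma sigma1_le: "sigma1_fun f \<Longrightarrow> sigma1_fun g \<Longrightarrow> sigma1_pred (\<lambda>e. f e \<le> g e)"
  by (rule ce2_app[of "(\<le>)"])
    (auto simp: ce2_def intro!: delta0_imp_sigma1 delta0_le term_fun_intros)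

lemmas sigma1_intros = sigma1_conj sigma1_disj sigma1_ex sigma1_eq sigma1_less sigma1_le
  sigma1_fun_prod_encode sigma1_fun_Suc sigma1_fun_Var sigma1_fun_const

lemma ce2_Delta0_formula:
  assumes "ce2 R"
  obtains A where "Delta0 A" "\<And>x y. (\<exists>w. evalF (env [w, x, y]) A) \<longleftrightarrow> R x y"
proof -
  obtain A where A: "Delta0 A" "\<And>e. R (e 0) (e 1) \<longleftrightarrow> (\<exists>w. evalF (case_nat w e) A)"
    using assms unfolding ce2_def sigma1_pred_def delta0_pred_def by metis
  have "(\<exists>w. evalF (env [w, x, y]) A) \<longleftrightarrow> R x y" for x y
    using A(2)[of "env [x, y]"] by simp
  with A(1) show ?thesis by (rule that)
qed

section \<open>Coded finite sets\<close>

lemma mem_set_decode_iff: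
  "u \<in> set_decode b \<longleftrightarrow> (\<exists>q \<le> b. \<exists>r \<le> b. b = q * 2 ^ Suc u + 2 ^ u + r \<and> r < 2 ^ u)"
proof
  assume "u \<in> set_decode b"
  then obtain q where q: "b div 2 ^ u = 2 * q + 1" by (auto simp: set_decode_def elim: oddE)
  have "b = (2 * q + 1) * 2 ^ u + b mod 2 ^ u" using q div_mult_mod_eq[of b "2 ^ u"] by simp
  then have b: "b = q * 2 ^ Suc u + 2 ^ u + b mod 2 ^ u" by (simp add: algebra_simps)
  have "q \<le> q * 2 ^ Suc u" by simp
  then have "q \<le> b" using b by linarith
  then show "\<exists>q \<le> b. \<exists>r \<le> b. b = q * 2 ^ Suc u + 2 ^ u + r \<and> r < 2 ^ u"
    using b by (intro exI[of _ q] exI[of _ "b mod 2 ^ u"] conjI) simp_all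
next
  assume "\<exists>q \<le> b. \<exists>r \<le> b. b = q * 2 ^ Suc u + 2 ^ u + r \<and> r < 2 ^ u"
  then obtain q r where b: "b = q * 2 ^ Suc u + 2 ^ u + r" and r: "r < 2 ^ u" by blast
  have "b = (2 * q + 1) * 2 ^ u + r" using b by (simp add: algebra_simps)
  moreover have "((2 * q + 1) * 2 ^ u + r) div 2 ^ u = (2 * q + 1) + r div 2 ^ u"
    by (rule div_mult_self3) simp
  ultimately have "b div 2 ^ u = 2 * q + 1" using r by (metis add.right_neutral div_less)
  then show "u \<in> set_decode b" by (simp add: set_decode_def)
qed

lemma less_if_mem_set_decode:
  assumes "u \<in> set_decode b"
  shows "u < b"
proof -
  obtain q r where "b = q * 2 ^ Suc u + 2 ^ u + r" using assms mem_set_decode_iff by blast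
  then show ?thesis using less_exp[of u] by linarith
qed

lemma set_encode_le_if_subset_atMost:
  assumes "X \<subseteq> {..s}"
  shows "set_encode X \<le> 2 ^ Suc s"
proof -
  have "set_encode X \<le> (\<Sum>i \<in> {..s}. 2 ^ i)"
    unfolding set_encode_def using assms by (intro sum_mono2) auto
  also have "\<dots> \<le> 2 ^ Suc s"
    by (induction s) auto
  finally show ?thesis .
qed

definition MemF :: fm where
  "MemF = BEx (Var 1) (BEx (Var 2) (Conj
     (Eqt (Var 3) (Pl (Pl (Tm (Var 1) (Ex2 (Sc (Var 2)))) (Ex2 (Var 2))) (Var 0)))
     (Leq (Sc (Var 0)) (Ex2 (Var 2)))))"

lemma Delta0_MemF: "Delta0 MemF"
  unfolding MemF_def by (intro Delta0_BEx Delta0_Conj Delta0.intros)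

lemma evalF_MemF: "evalF e MemF \<longleftrightarrow> e 0 \<in> set_decode (e 1)"
  unfolding MemF_def mem_set_decode_iff by (simp add: Suc_le_eq numeral_eq_Suc)

lemma delta0_mem_set_decode: "delta0_pred (\<lambda>e. e 0 \<in> set_decode (e 1))"
  unfolding delta0_pred_def using Delta0_MemF evalF_MemF by blast

lemma ce2_mem_set_decode: "ce2 (\<lambda>u b. u \<in> set_decode b)"
  unfolding ce2_def by (intro delta0_imp_sigma1 delta0_mem_set_decode)

lemma ce2_not_mem_set_decode: "ce2 (\<lambda>u b. u \<notin> set_decode b)"
  unfolding ce2_def by (intro delta0_imp_sigma1 delta0_not delta0_mem_set_decode)

section \<open>Inductively defined computably enumerable sets\<close>

text \<open>
  Two premises per rule suffice below, with repetition for rules with one. A derivation is a finite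
  set of pairs of a rank and a number in which each element follows from elements of smaller rank.
\<close>

inductive rule_closure :: "(nat \<Rightarrow> bool) \<Rightarrow> (nat \<Rightarrow> nat \<Rightarrow> nat \<Rightarrow> bool) \<Rightarrow> nat \<Rightarrow> bool" for B S where
  base: "B z \<Longrightarrow> rule_closure B S z"
| step: "rule_closure B S x \<Longrightarrow> rule_closure B S y \<Longrightarrow> S x y z \<Longrightarrow> rule_closure B S z"

definition derivation_step :: "(nat \<Rightarrow> bool) \<Rightarrow> (nat \<Rightarrow> nat \<Rightarrow> nat \<Rightarrow> bool) \<Rightarrow> nat set \<Rightarrow> nat \<Rightarrow> bool" where
  "derivation_step B S X p \<longleftrightarrow> (\<exists>r z. p = prod_encode (r, z) \<and> (B z \<or> (\<exists>x y r1 r2. r1 < r \<and> r2 < r \<and>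
     prod_encode (r1, x) \<in> X \<and> prod_encode (r2, y) \<in> X \<and> S x y z)))"

definition derivation :: "(nat \<Rightarrow> bool) \<Rightarrow> (nat \<Rightarrow> nat \<Rightarrow> nat \<Rightarrow> bool) \<Rightarrow> nat set \<Rightarrow> bool" where
  "derivation B S X \<longleftrightarrow> (\<forall>p \<in> X. derivation_step B S X p)"

lemma derivation_step_mono: "derivation_step B S X p \<Longrightarrow> X \<subseteq> Y \<Longrightarrow> derivation_step B S Y p"
  unfolding derivation_step_def by (elim exE disjE conjE; blast)

lemma derivation_Un: "derivation B S X \<Longrightarrow> derivation B S Y \<Longrightarrow> derivation B S (X \<union> Y)"
  unfolding derivation_def by (blast intro: derivation_step_mono)

lemma derivation_insert: "derivation B S X \<Longrightarrow> derivation_step B S X p \<Longrightarrow> derivation B S (insert p X)"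
  unfolding derivation_def by (blast intro: derivation_step_mono)

lemma rule_closure_if_derivation:
  assumes "derivation B S X"
  shows "prod_encode (r, z) \<in> X \<Longrightarrow> rule_closure B S z"
proof (induction r arbitrary: z rule: less_induct)
  case (less r)
  then have "derivation_step B S X (prod_encode (r, z))" using assms by (auto simp: derivation_def)
  then consider (base) "B z" | (step) x y r1 r2 where "r1 < r" "r2 < r" "prod_encode (r1, x) \<in> X"
      "prod_encode (r2, y) \<in> X" "S x y z"
    unfolding derivation_step_def by auto
  then show ?case
  proof cases
    case base
    then show ?thesis by (rule rule_closure.base)
  next
    case step
    then show ?thesis using less.IH by (blast intro: rule_closure.step)
  qed
qed

lemma derivation_if_rule_closure:
  "rule_closure B S z \<Longrightarrow> \<exists>X r. finite X \<and> derivation B S X \<and> prod_encode (r, z) \<in> X"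
proof (induction rule: rule_closure.induct)
  case (base z)
  then have "derivation B S {prod_encode (0, z)}"
    unfolding derivation_def derivation_step_def by blast
  then show ?case by (intro exI[of _ "{prod_encode (0, z)}"] exI[of _ 0]) simp
next
  case (step x y z)
  then obtain X Y r s where X: "finite X" "derivation B S X" "prod_encode (r, x) \<in> X"
    and Y: "finite Y" "derivation B S Y" "prod_encode (s, y) \<in> Y" by blast
  define t where "t = Suc (max r s)"
  have "r < t" "s < t" by (auto simp: t_def)
  then have "derivation_step B S (X \<union> Y) (prod_encode (t, z))"
    unfolding derivation_step_def using step.hyps(3) X(3) Y(3) by blast
  then have "derivation B S (insert (prod_encode (t, z)) (X \<union> Y))"
    by (intro derivation_insert derivation_Un X(2) Y(2))
  then show ?case using X(1) Y(1) by (meson finite.insertI finite_UnI insertI1)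
qed

lemma rule_closure_iff_coded_derivation:
  "rule_closure B S z \<longleftrightarrow> (\<exists>b r. prod_encode (r, z) \<in> set_decode b \<and> derivation B S (set_decode b))"
proof
  assume "rule_closure B S z"
  then obtain X r where "finite X" "derivation B S X" "prod_encode (r, z) \<in> X"
    using derivation_if_rule_closure by blast
  then show "\<exists>b r. prod_encode (r, z) \<in> set_decode b \<and> derivation B S (set_decode b)"
    using set_encode_inverse by metis
qed (blast intro: rule_closure_if_derivation)

lemma ce1_rule_closure:
  assumes "ce1 B" "ce3 S"
  shows "ce1 (rule_closure B S)"
proof -
  have "derivation B S (set_decode b) \<longleftrightarrow>
      (\<forall>p \<le> b. p \<notin> set_decode b \<or> derivation_step B S (set_decode b) p)" for b
    using less_if_mem_set_decode[of _ b] by (auto simp: derivation_def less_imp_le)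
  then show ?thesis
    unfolding ce1_def rule_closure_iff_coded_derivation derivation_step_def
    by (simp only:) (intro sigma1_intros sigma1_ball term_fun_Var ce1_app[OF assms(1)]
        ce3_app[OF assms(2)] ce2_app[OF ce2_mem_set_decode] ce2_app[OF ce2_not_mem_set_decode])
qed

section \<open>Coded syntax\<close>

lemma codeT_eq_iff [simp]: "codeT t = codeT s \<longleftrightarrow> t = s"
  by (induction t arbitrary: s; case_tac s; simp)

lemma codeF_eq_iff [simp]: "codeF A = codeF B \<longleftrightarrow> A = B"
  by (induction A arbitrary: B; case_tac B; simp)

abbreviation triple_encode :: "nat \<Rightarrow> nat \<Rightarrow> nat \<Rightarrow> nat" where
  "triple_encode p a b \<equiv> prod_encode (p, prod_encode (a, b))"

abbreviation var_code :: "nat \<Rightarrow> nat" where "var_code i \<equiv> prod_encode (0, i)"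
abbreviation Zr_code :: nat where "Zr_code \<equiv> prod_encode (1, 0)"
abbreviation Sc_code :: "nat \<Rightarrow> nat" where "Sc_code a \<equiv> prod_encode (2, a)"
abbreviation Pl_code :: "nat \<Rightarrow> nat \<Rightarrow> nat" where "Pl_code \<equiv> triple_encode 3"
abbreviation Tm_code :: "nat \<Rightarrow> nat \<Rightarrow> nat" where "Tm_code \<equiv> triple_encode 4"
abbreviation Ex2_code :: "nat \<Rightarrow> nat" where "Ex2_code a \<equiv> prod_encode (5, a)"

abbreviation Fls_code :: nat where "Fls_code \<equiv> prod_encode (0, 0)"
abbreviation Eqt_code :: "nat \<Rightarrow> nat \<Rightarrow> nat" where "Eqt_code \<equiv> triple_encode 1"
abbreviation Leq_code :: "nat \<Rightarrow> nat \<Rightarrow> nat" where "Leq_code \<equiv> triple_encode 2"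
abbreviation Imp_code :: "nat \<Rightarrow> nat \<Rightarrow> nat" where "Imp_code \<equiv> triple_encode 3"
abbreviation Forall_code :: "nat \<Rightarrow> nat" where "Forall_code a \<equiv> prod_encode (4, a)"
abbreviation Neg_code :: "nat \<Rightarrow> nat" where "Neg_code a \<equiv> Imp_code a Fls_code"

lemma Fls_code_eq_codeF_iff: "Fls_code = codeF C \<longleftrightarrow> C = Fls"
  by (cases C) auto

lemma Imp_code_eq_codeF_iff:
  "Imp_code a b = codeF C \<longleftrightarrow> (\<exists>A B. a = codeF A \<and> b = codeF B \<and> C = Imp A B)"
  by (cases C) auto

text \<open>
  A family of substitutions indexed by parameters \<open>p\<close>: the relation \<open>V\<close> gives the coded values on
  variables, and \<open>Up\<close> is the change of parameter on entering a quantifier. Lifting (\<open>p = k\<close>) and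
  single substitution (\<open>p\<close> a coded pair of \<open>k\<close> and the term) are instances.
\<close>

locale coded_substitution =
  fixes ok :: "nat \<Rightarrow> bool" and \<sigma> :: "nat \<Rightarrow> nat \<Rightarrow> trm"
    and V :: "nat \<Rightarrow> nat \<Rightarrow> nat \<Rightarrow> bool" and Up :: "nat \<Rightarrow> nat \<Rightarrow> bool"
  assumes ce_ok: "ce1 ok" and ce_V: "ce3 V" and ce_Up: "ce2 Up"
    and V_iff: "V p i v \<longleftrightarrow> ok p \<and> v = codeT (\<sigma> p i)"
    and Up_ok: "ok p \<Longrightarrow> Up p q \<Longrightarrow> ok q"
    and Up_up: "ok p \<Longrightarrow> Up p q \<Longrightarrow> \<sigma> q = up (\<sigma> p)"
    and Up_ex: "ok p \<Longrightarrow> \<exists>q. Up p q"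
begin

definition psubT_code :: "nat \<Rightarrow> nat \<Rightarrow> nat \<Rightarrow> bool" where
  "psubT_code p a a' \<longleftrightarrow> ok p \<and> (\<exists>t. a = codeT t \<and> a' = codeT (psubT (\<sigma> p) t))"

definition psubF_code :: "nat \<Rightarrow> nat \<Rightarrow> nat \<Rightarrow> bool" where
  "psubF_code p a a' \<longleftrightarrow> ok p \<and> (\<exists>A. a = codeF A \<and> a' = codeF (psubF (\<sigma> p) A))"

definition psubT_base :: "nat \<Rightarrow> bool" where
  "psubT_base z \<longleftrightarrow> (\<exists>p i v. V p i v \<and> z = triple_encode p (var_code i) v)
     \<or> (\<exists>p. ok p \<and> z = triple_encode p Zr_code Zr_code)"

definition psubT_step :: "nat \<Rightarrow> nat \<Rightarrow> nat \<Rightarrow> bool" where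
  "psubT_step x y z \<longleftrightarrow> (\<exists>p a a' b b'. x = triple_encode p a a' \<and> y = triple_encode p b b' \<and>
     (z = triple_encode p (Sc_code a) (Sc_code a') \<or>
      z = triple_encode p (Ex2_code a) (Ex2_code a') \<or>
      z = triple_encode p (Pl_code a b) (Pl_code a' b') \<or>
      z = triple_encode p (Tm_code a b) (Tm_code a' b')))"

lemma ce1_psubT_base: "ce1 psubT_base"
  unfolding ce1_def psubT_base_def by (intro sigma1_intros ce3_app[OF ce_V] ce1_app[OF ce_ok])

lemma ce3_psubT_step: "ce3 psubT_step"
  unfolding ce3_def psubT_step_def by (intro sigma1_intros)

lemma psubT_code_if_rule_closure:
  "rule_closure psubT_base psubT_step z \<Longrightarrow> \<exists>p a a'. z = triple_encode p a a' \<and> psubT_code p a a'"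
proof (induction rule: rule_closure.induct)
  case (base z)
  then consider p i where "ok p" "z = triple_encode p (codeT (Var i)) (codeT (psubT (\<sigma> p) (Var i)))"
    | p where "ok p" "z = triple_encode p (codeT Zr) (codeT (psubT (\<sigma> p) Zr))"
    unfolding psubT_base_def V_iff by auto
  then show ?case unfolding psubT_code_def by cases blast+
next
  case (step x y z)
  then obtain p t s where "ok p" and "z \<in> (\<lambda>u. triple_encode p (codeT u) (codeT (psubT (\<sigma> p) u))) `
      {Sc t, Ex2 t, Pl t s, Tm t s}"
    unfolding psubT_step_def psubT_code_def by auto
  then show ?case unfolding psubT_code_def by blast
qed

lemma rule_closure_psubT:
  assumes "ok p"
  shows "rule_closure psubT_base psubT_step (triple_encode p (codeT t) (codeT (psubT (\<sigma> p) t)))"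
proof (induction t)
  case (Var i)
  have "V p i (codeT (\<sigma> p i))" using assms by (simp add: V_iff)
  then show ?case by (intro rule_closure.base) (auto simp: psubT_base_def)
next
  case Zr
  show ?case by (rule rule_closure.base) (use assms in \<open>auto simp: psubT_base_def\<close>)
next
  case (Sc t)
  show ?case by (rule rule_closure.step[OF Sc Sc]) (auto simp: psubT_step_def)
next
  case (Ex2 t)
  show ?case by (rule rule_closure.step[OF Ex2 Ex2]) (auto simp: psubT_step_def)
next
  case (Pl t s)
  show ?case by (rule rule_closure.step[OF Pl]) (auto simp: psubT_step_def)
next
  case (Tm t s)
  show ?case by (rule rule_closure.step[OF Tm]) (auto simp: psubT_step_def)
qed

lemma ce3_psubT_code: "ce3 psubT_code"
proof -
  have "psubT_code p a a' \<longleftrightarrow> rule_closure psubT_base psubT_step (triple_encode p a a')" for p a a'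
    using psubT_code_if_rule_closure[of "triple_encode p a a'"] rule_closure_psubT[of p]
    by (auto simp: psubT_code_def)
  then show ?thesis unfolding ce3_def
    by (simp only:)
      (intro sigma1_intros ce1_app[OF ce1_rule_closure[OF ce1_psubT_base ce3_psubT_step]])
qed

definition psubF_base :: "nat \<Rightarrow> bool" where
  "psubF_base z \<longleftrightarrow> (\<exists>p. ok p \<and> z = triple_encode p Fls_code Fls_code)
     \<or> (\<exists>p a a' b b'. psubT_code p a a' \<and> psubT_code p b b' \<and>
        (z = triple_encode p (Eqt_code a b) (Eqt_code a' b') \<or>
         z = triple_encode p (Leq_code a b) (Leq_code a' b')))"

definition psubF_step :: "nat \<Rightarrow> nat \<Rightarrow> nat \<Rightarrow> bool" where
  "psubF_step x y z \<longleftrightarrow> (\<exists>p a a' b b'. x = triple_encode p a a' \<and> y = triple_encode p b b' \<and>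
      z = triple_encode p (Imp_code a b) (Imp_code a' b')) \<or>
     (\<exists>p q a a'. ok p \<and> Up p q \<and> x = triple_encode q a a' \<and>
      z = triple_encode p (Forall_code a) (Forall_code a'))"

lemma ce1_psubF_base: "ce1 psubF_base"
  unfolding ce1_def psubF_base_def
  by (intro sigma1_intros ce3_app[OF ce3_psubT_code] ce1_app[OF ce_ok])

lemma ce3_psubF_step: "ce3 psubF_step"
  unfolding ce3_def psubF_step_def by (intro sigma1_intros ce2_app[OF ce_Up] ce1_app[OF ce_ok])

lemma psubF_code_if_rule_closure:
  "rule_closure psubF_base psubF_step z \<Longrightarrow> \<exists>p a a'. z = triple_encode p a a' \<and> psubF_code p a a'"
proof (induction rule: rule_closure.induct)
  case (base z)
  then obtain p t s where "ok p" and "z \<in> (\<lambda>A. triple_encode p (codeF A) (codeF (psubF (\<sigma> p) A))) `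
      {Fls, Eqt t s, Leq t s}"
    unfolding psubF_base_def psubT_code_def by auto
  then show ?case unfolding psubF_code_def by blast
next
  case (step x y z)
  then consider p A B where "ok p"
      "z = triple_encode p (codeF (Imp A B)) (codeF (psubF (\<sigma> p) (Imp A B)))"
    | p A where "ok p" "z = triple_encode p (codeF (Forall A)) (codeF (psubF (\<sigma> p) (Forall A)))"
    unfolding psubF_step_def psubF_code_def using Up_up by auto
  then show ?case unfolding psubF_code_def by cases blast+
qed

lemma rule_closure_psubF:
  "ok p \<Longrightarrow> rule_closure psubF_base psubF_step (triple_encode p (codeF A) (codeF (psubF (\<sigma> p) A)))"
proof (induction A arbitrary: p)
  case Fls
  then show ?case by (intro rule_closure.base) (auto simp: psubF_base_def)
next
  case (Eqt t s)
  then have "psubT_code p (codeT u) (codeT (psubT (\<sigma> p) u))" for u by (auto simp: psubT_code_def)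
  then show ?case by (intro rule_closure.base) (auto simp: psubF_base_def)
next
  case (Leq t s)
  then have "psubT_code p (codeT u) (codeT (psubT (\<sigma> p) u))" for u by (auto simp: psubT_code_def)
  then show ?case by (intro rule_closure.base) (auto simp: psubF_base_def)
next
  case (Imp A B)
  show ?case
    by (rule rule_closure.step[OF Imp.IH(1)[OF Imp.prems] Imp.IH(2)[OF Imp.prems]])
      (auto simp: psubF_step_def)
next
  case (Forall A)
  obtain q where q: "Up p q" using Up_ex Forall.prems by blast
  note IH = Forall.IH[OF Up_ok[OF Forall.prems q]]
  show ?case
    by (rule rule_closure.step[OF IH IH]) (use q Forall.prems Up_up in \<open>auto simp: psubF_step_def\<close>)
qed

lemma ce3_psubF_code: "ce3 psubF_code"
proof -
  have "psubF_code p a a' \<longleftrightarrow> rule_closure psubF_base psubF_step (triple_encode p a a')" for p a a'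
    using psubF_code_if_rule_closure[of "triple_encode p a a'"] rule_closure_psubF[of p]
    by (auto simp: psubF_code_def)
  then show ?thesis unfolding ce3_def
    by (simp only:)
      (intro sigma1_intros ce1_app[OF ce1_rule_closure[OF ce1_psubF_base ce3_psubF_step]])
qed

end

definition lift_var_code :: "nat \<Rightarrow> nat \<Rightarrow> nat \<Rightarrow> bool" where
  "lift_var_code k i v \<longleftrightarrow> (i < k \<and> v = var_code i) \<or> (k \<le> i \<and> v = var_code (Suc i))"

interpretation lift: coded_substitution "\<lambda>_. True" lift_var lift_var_code "\<lambda>p q. q = Suc p"
proof
  show "ce1 (\<lambda>_. True)"
    using sigma1_eq[of "\<lambda>e. 0" "\<lambda>e. 0"] by (simp add: ce1_def sigma1_fun_const)
  show "ce3 lift_var_code"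
    unfolding ce3_def lift_var_code_def by (intro sigma1_intros)
  show "ce2 (\<lambda>p q. q = Suc p)"
    unfolding ce2_def by (intro sigma1_intros)
qed (auto simp: lift_var_code_def lift_var_def up_lift_var)

definition liftT_code :: "nat \<Rightarrow> nat \<Rightarrow> bool" where
  "liftT_code a b \<longleftrightarrow> (\<exists>t. a = codeT t \<and> b = codeT (liftT 0 t))"

definition liftF_code :: "nat \<Rightarrow> nat \<Rightarrow> bool" where
  "liftF_code a b \<longleftrightarrow> (\<exists>A. a = codeF A \<and> b = codeF (liftF 0 A))"

lemma ce2_liftT_code: "ce2 liftT_code"
proof -
  have "liftT_code a b \<longleftrightarrow> lift.psubT_code 0 a b" for a b
    unfolding liftT_code_def lift.psubT_code_def liftT_eq_psubT by simp
  then show ?thesis unfolding ce2_def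
    by (simp only:) (intro ce3_app[OF lift.ce3_psubT_code] sigma1_intros)
qed

lemma ce2_liftF_code: "ce2 liftF_code"
proof -
  have "liftF_code a b \<longleftrightarrow> lift.psubF_code 0 a b" for a b
    unfolding liftF_code_def lift.psubF_code_def liftF_eq_psubF by simp
  then show ?thesis unfolding ce2_def
    by (simp only:) (intro ce3_app[OF lift.ce3_psubF_code] sigma1_intros)
qed

lemma ce1_range_codeT: "ce1 (\<lambda>a. a \<in> range codeT)"
proof -
  have "a \<in> range codeT \<longleftrightarrow> (\<exists>b. liftT_code a b)" for a
    unfolding liftT_code_def by blast
  then show ?thesis unfolding ce1_def
    by (simp only:) (intro ce2_app[OF ce2_liftT_code] sigma1_intros)
qed

lemma ce1_range_codeF: "ce1 (\<lambda>a. a \<in> range codeF)"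
proof -
  have "a \<in> range codeF \<longleftrightarrow> (\<exists>b. liftF_code a b)" for a
    unfolding liftF_code_def by blast
  then show ?thesis unfolding ce1_def
    by (simp only:) (intro ce2_app[OF ce2_liftF_code] sigma1_intros)
qed

definition subst_ok :: "nat \<Rightarrow> bool" where
  "subst_ok p \<longleftrightarrow> (\<exists>k u. p = prod_encode (k, u) \<and> u \<in> range codeT)"

definition subst_of_code :: "nat \<Rightarrow> nat \<Rightarrow> trm" where
  "subst_of_code p = (case prod_decode p of (k, u) \<Rightarrow> subst_var k (inv codeT u))"

definition subst_var_code :: "nat \<Rightarrow> nat \<Rightarrow> nat \<Rightarrow> bool" where
  "subst_var_code p i v \<longleftrightarrow> (\<exists>k u. p = prod_encode (k, u) \<and> u \<in> range codeT \<and>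
     ((i < k \<and> v = var_code i) \<or> (i = k \<and> v = u) \<or> (\<exists>j. i = Suc j \<and> k < i \<and> v = var_code j)))"

definition subst_up :: "nat \<Rightarrow> nat \<Rightarrow> bool" where
  "subst_up p q \<longleftrightarrow> (\<exists>k u u'. p = prod_encode (k, u) \<and> liftT_code u u' \<and> q = prod_encode (Suc k, u'))"

lemma inv_codeT [simp]: "inv codeT (codeT t) = t"
  by (rule inv_f_f) (simp add: inj_def)

interpretation subst: coded_substitution subst_ok subst_of_code subst_var_code subst_up
proof
  show "ce1 subst_ok"
    unfolding ce1_def subst_ok_def by (intro sigma1_intros ce1_app[OF ce1_range_codeT])
  show "ce3 subst_var_code"
    unfolding ce3_def subst_var_code_def by (intro sigma1_intros ce1_app[OF ce1_range_codeT])
  show "ce2 subst_up"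
    unfolding ce2_def subst_up_def by (intro sigma1_intros ce2_app[OF ce2_liftT_code])
  show "subst_var_code p i v \<longleftrightarrow> subst_ok p \<and> v = codeT (subst_of_code p i)" for p i v
  proof -
    obtain k u where p: "p = prod_encode (k, u)" by (metis prod_decode_inverse surj_pair)
    have "(\<exists>j. i = Suc j \<and> k < i \<and> v = var_code j) \<longleftrightarrow> k < i \<and> v = var_code (i - 1)"
      by (cases i) auto
    then show ?thesis unfolding subst_var_code_def subst_ok_def subst_of_code_def p
      by (auto simp: subst_var_def)
  qed
qed (auto simp: subst_ok_def subst_up_def liftT_code_def subst_of_code_def up_subst_var)

definition inst_code :: "nat \<Rightarrow> nat \<Rightarrow> nat \<Rightarrow> bool" where
  "inst_code a u b \<longleftrightarrow> (\<exists>A t. a = codeF A \<and> u = codeT t \<and> b = codeF (inst A t))"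

lemma ce3_inst_code: "ce3 inst_code"
proof -
  have "inst_code a u b \<longleftrightarrow> subst.psubF_code (prod_encode (0, u)) a b" for a u b
    unfolding inst_code_def subst.psubF_code_def inst_def substF_eq_psubF subst_ok_def
      subst_of_code_def by auto
  then show ?thesis unfolding ce3_def
    by (simp only:) (intro ce3_app[OF subst.ce3_psubF_code] sigma1_intros)
qed

lemma ce2_num_code: "ce2 (\<lambda>n c. c = codeT (num n))"
proof -
  define B where "B z \<longleftrightarrow> z = prod_encode (0, Zr_code)" for z
  define S where "S x y z \<longleftrightarrow> (\<exists>n c. x = prod_encode (n, c) \<and> z = prod_encode (Suc n, Sc_code c))"
    for x y z :: nat
  have "ce1 B" unfolding ce1_def B_def by (intro sigma1_intros)
  moreover have "ce3 S" unfolding ce3_def S_def by (intro sigma1_intros)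
  ultimately have ce1_closure: "ce1 (rule_closure B S)" by (rule ce1_rule_closure)
  have "rule_closure B S (prod_encode (n, codeT (num n)))" for n
  proof (induction n)
    case 0
    show ?case by (rule rule_closure.base) (simp add: B_def)
  next
    case (Suc n)
    show ?case by (rule rule_closure.step[OF Suc Suc]) (simp add: S_def)
  qed
  moreover have "\<exists>n. z = prod_encode (n, codeT (num n))" if "rule_closure B S z" for z
    using that
  proof (induction rule: rule_closure.induct)
    case (base z)
    then show ?case by (intro exI[of _ 0]) (simp add: B_def)
  next
    case (step x y z)
    then obtain n where "x = prod_encode (n, codeT (num n))" by blast
    then show ?case using step.hyps(3) by (intro exI[of _ "Suc n"]) (auto simp: S_def)
  qed
  ultimately have "c = codeT (num n) \<longleftrightarrow> rule_closure B S (prod_encode (n, c))" for n c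
    by fastforce
  then show ?thesis unfolding ce2_def
    by (simp only:) (intro ce1_app[OF ce1_closure] sigma1_intros)
qed

section \<open>Coded provability\<close>

lemma ce1_theory:
  assumes "ce_theory U"
  shows "ce1 (\<lambda>n. n \<in> codeF ` U)"
proof -
  obtain \<sigma> where \<sigma>: "Sigma1 \<sigma>" "closedF 1 \<sigma>" "\<And>n. n \<in> codeF ` U \<longleftrightarrow> evalF (\<lambda>_. 0) (inst \<sigma> (num n))"
    using assms unfolding ce_theory_def by blast
  have "evalF (\<lambda>_. 0) (inst \<sigma> (num (e 0))) = evalF e \<sigma>" for e
    unfolding inst_eq_psubF evalF_psubF by (rule evalF_cong_closed[OF \<sigma>(2)]) simp
  then show ?thesis unfolding ce1_def \<sigma>(3) using sigma1_evalF[OF \<sigma>(1)] by simp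
qed

definition hilbert_axiom :: "fm set \<Rightarrow> fm \<Rightarrow> bool" where
  "hilbert_axiom U F \<longleftrightarrow> F \<in> U
   \<or> (\<exists>A B. F = Imp A (Imp B A))
   \<or> (\<exists>A B C. F = Imp (Imp A (Imp B C)) (Imp (Imp A B) (Imp A C)))
   \<or> (\<exists>A. F = Imp (Imp (Imp A Fls) Fls) A)
   \<or> (\<exists>A t. F = Imp (Forall A) (inst A t))
   \<or> (\<exists>A B. F = Imp (Forall (Imp (liftF 0 A) B)) (Imp A (Forall B)))
   \<or> (\<exists>t. F = Eqt t t)
   \<or> (\<exists>t s A. F = Imp (Eqt t s) (Imp (inst A t) (inst A s)))"

abbreviation axiom_codes :: "fm set \<Rightarrow> nat set" where
  "axiom_codes U \<equiv> codeF ` {F. hilbert_axiom U F}"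

abbreviation theorem_codes :: "fm set \<Rightarrow> nat set" where
  "theorem_codes U \<equiv> codeF ` {A. proves U A}"

lemma proves_hilbert_axiom: "hilbert_axiom U A \<Longrightarrow> proves U A"
  unfolding hilbert_axiom_def by (elim disjE exE) (simp_all only: proves.intros)

lemma ce1_axiom_codes:
  assumes "ce_theory U"
  shows "ce1 (\<lambda>z. z \<in> axiom_codes U)"
proof -
  have axiom_codes_iff: "z \<in> axiom_codes U \<longleftrightarrow> z \<in> codeF ` U
     \<or> (\<exists>a b. a \<in> range codeF \<and> b \<in> range codeF \<and> z = Imp_code a (Imp_code b a))
     \<or> (\<exists>a b c. a \<in> range codeF \<and> b \<in> range codeF \<and> c \<in> range codeF \<and>
          z = Imp_code (Imp_code a (Imp_code b c)) (Imp_code (Imp_code a b) (Imp_code a c)))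
     \<or> (\<exists>a. a \<in> range codeF \<and> z = Imp_code (Neg_code (Neg_code a)) a)
     \<or> (\<exists>a t b. inst_code a t b \<and> z = Imp_code (Forall_code a) b)
     \<or> (\<exists>a a' b. liftF_code a a' \<and> b \<in> range codeF \<and>
          z = Imp_code (Forall_code (Imp_code a' b)) (Imp_code a (Forall_code b)))
     \<or> (\<exists>t. t \<in> range codeT \<and> z = Eqt_code t t)
     \<or> (\<exists>t s a b c. inst_code a t b \<and> inst_code a s c \<and> z = Imp_code (Eqt_code t s) (Imp_code b c))"
    (is "_ \<longleftrightarrow> ?R") for z
  proof -
    have "z \<in> axiom_codes U \<longleftrightarrow> z \<in> codeF ` U
       \<or> (\<exists>A B. z = codeF (Imp A (Imp B A)))
       \<or> (\<exists>A B C. z = codeF (Imp (Imp A (Imp B C)) (Imp (Imp A B) (Imp A C))))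
       \<or> (\<exists>A. z = codeF (Imp (Imp (Imp A Fls) Fls) A))
       \<or> (\<exists>A t. z = codeF (Imp (Forall A) (inst A t)))
       \<or> (\<exists>A B. z = codeF (Imp (Forall (Imp (liftF 0 A) B)) (Imp A (Forall B))))
       \<or> (\<exists>t. z = codeF (Eqt t t))
       \<or> (\<exists>t s A. z = codeF (Imp (Eqt t s) (Imp (inst A t) (inst A s))))"
      unfolding hilbert_axiom_def image_iff by blast
    also have "\<dots> \<longleftrightarrow> ?R"
      unfolding inst_code_def liftF_code_def image_iff codeF.simps
      by (intro arg_cong2[of _ _ _ _ "(\<or>)"] refl iffI; auto; blast)
    finally show ?thesis .
  qed
  show ?thesis
    unfolding ce1_def axiom_codes_iff
    by (intro sigma1_intros ce1_app[OF ce1_theory[OF assms]] ce1_app[OF ce1_range_codeF]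
        ce1_app[OF ce1_range_codeT] ce2_app[OF ce2_liftF_code] ce3_app[OF ce3_inst_code])
qed

definition inference_code :: "nat \<Rightarrow> nat \<Rightarrow> nat \<Rightarrow> bool" where
  "inference_code x y z \<longleftrightarrow> x = Imp_code y z \<or> z = Forall_code x"

lemma rule_closure_if_proves:
  "proves U A \<Longrightarrow> rule_closure (\<lambda>z. z \<in> axiom_codes U) inference_code (codeF A)"
proof (induction rule: proves.induct)
  case (mp U A B)
  show ?case by (rule rule_closure.step[OF mp.IH]) (simp add: inference_code_def)
next
  case (gen U A)
  show ?case by (rule rule_closure.step[OF gen.IH gen.IH]) (simp add: inference_code_def)
qed (rule rule_closure.base, rule imageI, force simp: hilbert_axiom_def)+

lemma mem_theorem_codes_if_rule_closure:
  "rule_closure (\<lambda>z. z \<in> axiom_codes U) inference_code z \<Longrightarrow> z \<in> theorem_codes U"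
proof (induction rule: rule_closure.induct)
  case (base z)
  then show ?case using proves_hilbert_axiom by blast
next
  case (step x y z)
  then obtain A B where A: "x = codeF A" "proves U A" and B: "y = codeF B" "proves U B" by blast
  from step.hyps(3) consider (mp) "Imp_code y z = codeF A" | (gen) "z = Forall_code x"
    unfolding inference_code_def A(1) by metis
  then show ?case
  proof cases
    case mp
    then obtain C where "z = codeF C" "A = Imp B C" using B(1) by (auto simp: Imp_code_eq_codeF_iff)
    then show ?thesis using proves.mp A(2) B(2) by blast
  next
    case gen
    then have "z = codeF (Forall A)" using A(1) by simp
    then show ?thesis using proves.gen[OF A(2)] by blast
  qed
qed

lemma ce1_theorem_codes:
  assumes "ce_theory U"
  shows "ce1 (\<lambda>z. z \<in> theorem_codes U)"
proof -
  have "z \<in> theorem_codes U \<longleftrightarrow>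
      rule_closure (\<lambda>z. z \<in> axiom_codes U) inference_code z" for z
    using rule_closure_if_proves mem_theorem_codes_if_rule_closure by blast
  moreover have "ce3 inference_code"
    unfolding ce3_def inference_code_def by (intro sigma1_intros)
  ultimately show ?thesis using ce1_rule_closure[OF ce1_axiom_codes[OF assms]] by simp
qed

section \<open>The stage formulas\<close>

text \<open>
  Free variables: in \<open>ClosedF\<close>, 0 is the coded set and 1 the stage; in \<open>StageF\<close> and \<open>RosserF\<close>, 0 is
  the stage, 1 the code of the self-applied formula and 2 the code \<open>x\<close>. The formula \<open>E\<close> takes a
  witness and two codes; \<open>F\<close>, \<open>P\<close> and \<open>N\<close> take a witness, the code of the self-applied formula and a
  code.
\<close>

definition ClosedF :: "fm \<Rightarrow> fm" where
  "ClosedF E = BAll (Var 1) (BAll (Var 2) (BAll (Var 3) (Imp (ap E [Var 0, Var 2, Var 1])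
     (Imp (ap MemF [Var 2, Var 3]) (ap MemF [Var 1, Var 3])))))"

definition StageF :: "fm \<Rightarrow> fm \<Rightarrow> fm" where
  "StageF E F = Conj (Leq (Var 2) (Var 0)) (BAll (Ex2 (Sc (Var 0)))
     (Imp (ClosedF E) (Imp (ap MemF [Var 3, Var 0])
       (BEx (Var 1) (Conj (ap MemF [Var 0, Var 1]) (BEx (Var 2) (ap F [Var 0, Var 4, Var 1])))))))"

definition RosserF :: "fm \<Rightarrow> fm \<Rightarrow> fm \<Rightarrow> fm" where
  "RosserF E P N = Imp (StageF E P) (BEx (Var 0) (ap (StageF E N) [Var 0, Var 2, Var 3]))"

lemma Delta0_StageF: "Delta0 E \<Longrightarrow> Delta0 F \<Longrightarrow> Delta0 (StageF E F)"
  unfolding StageF_def ClosedF_def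
  by (intro Delta0_Conj Delta0_BAll Delta0_BEx Delta0_psubF Delta0_MemF Delta0.intros) auto

lemma Delta0_RosserF: "Delta0 E \<Longrightarrow> Delta0 P \<Longrightarrow> Delta0 N \<Longrightarrow> Delta0 (RosserF E P N)"
  unfolding RosserF_def by (intro Delta0_BEx Delta0_psubF Delta0.intros(4) Delta0_StageF)

lemma closedF_RosserF: "closedF 3 (RosserF E P N)"
  unfolding RosserF_def StageF_def ClosedF_def by (simp add: closedF_ap)

definition found_by :: "fm \<Rightarrow> nat \<Rightarrow> nat rel" where
  "found_by E s = {(u, v). u \<le> s \<and> v \<le> s \<and> (\<exists>w \<le> s. evalF (env [w, u, v]) E)}"

lemma evalF_ClosedF:
  "evalF (env (b # s # xs)) (ClosedF E) \<longleftrightarrow> found_by E s `` set_decode b \<subseteq> set_decode b"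
  unfolding ClosedF_def found_by_def by (auto simp: evalF_MemF)

lemma found_by_rtrancl_le: "(x, c) \<in> (found_by E s)\<^sup>* \<Longrightarrow> x \<le> s \<Longrightarrow> c \<le> s"
  by (induction rule: rtrancl_induct) (auto simp: found_by_def)

lemma closed_sets_meet_iff_reachable:
  assumes "x \<le> s"
  shows "(\<forall>b \<le> 2 ^ Suc s. found_by E s `` set_decode b \<subseteq> set_decode b \<longrightarrow> x \<in> set_decode b
      \<longrightarrow> (\<exists>c \<le> s. c \<in> set_decode b \<and> Q c)) \<longleftrightarrow> (\<exists>c. (x, c) \<in> (found_by E s)\<^sup>* \<and> Q c)"
    (is "?closed \<longleftrightarrow> ?reachable")
proof
  assume closed: ?closed
  define X where "X = (found_by E s)\<^sup>* `` {x}"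
  have "X \<subseteq> {..s}" using assms found_by_rtrancl_le by (auto simp: X_def)
  then have code: "set_encode X \<le> 2 ^ Suc s" "set_decode (set_encode X) = X"
    using set_encode_le_if_subset_atMost set_encode_inverse finite_subset[OF _ finite_atMost]
    by blast+
  have "found_by E s `` X \<subseteq> X" "x \<in> X" by (auto simp: X_def intro: rtrancl_into_rtrancl)
  then obtain c where "c \<in> X" "Q c"
    using closed[rule_format, OF code(1)] unfolding code(2) by blast
  then show ?reachable by (auto simp: X_def)
next
  assume ?reachable
  then obtain c where c: "(x, c) \<in> (found_by E s)\<^sup>*" "Q c" by blast
  have "c \<in> X" if "found_by E s `` X \<subseteq> X" "x \<in> X" for X
    using c(1) that by (induction rule: rtrancl_induct) auto
  then show ?closed using c(2) found_by_rtrancl_le[OF c(1) assms] by blast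
qed

lemma evalF_StageF:
  "evalF (env [s, k, x]) (StageF E F) \<longleftrightarrow>
    x \<le> s \<and> (\<exists>c. (x, c) \<in> (found_by E s)\<^sup>* \<and> (\<exists>w \<le> s. evalF (env [w, k, c]) F))"
proof -
  have "evalF (env [s, k, x]) (StageF E F) \<longleftrightarrow> x \<le> s \<and> (\<forall>b \<le> 2 ^ Suc s.
      found_by E s `` set_decode b \<subseteq> set_decode b \<longrightarrow> x \<in> set_decode b
      \<longrightarrow> (\<exists>c \<le> s. c \<in> set_decode b \<and> (\<exists>w \<le> s. evalF (env [w, k, c]) F)))"
    unfolding StageF_def by (simp add: evalF_ClosedF evalF_MemF)
  also have "\<dots> \<longleftrightarrow> x \<le> s \<and> (\<exists>c. (x, c) \<in> (found_by E s)\<^sup>* \<and> (\<exists>w \<le> s. evalF (env [w, k, c]) F))"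
    by (rule conj_cong[OF refl]) (rule closed_sets_meet_iff_reachable)
  finally show ?thesis .
qed

lemma evalF_StageF_self:
  "evalF (env [w, k, x]) F \<Longrightarrow> w \<le> s \<Longrightarrow> x \<le> s \<Longrightarrow> evalF (env [s, k, x]) (StageF E F)"
  unfolding evalF_StageF by blast

lemma evalF_RosserF: "evalF (env [s, k, x]) (RosserF E P N) \<longleftrightarrow>
    (evalF (env [s, k, x]) (StageF E P) \<longrightarrow> (\<exists>t \<le> s. evalF (env [t, k, x]) (StageF E N)))"
  unfolding RosserF_def by simp

lemma EA_ClosedF_step:
  assumes "Delta0 E" "evalF (env [w, u, v]) E" "w \<le> n" "u \<le> n" "v \<le> n"
  shows "proves EA (Imp (Leq (num n) (Var 1)) (Imp (ClosedF E)
      (Imp (ap MemF [num u, Var 0]) (ap MemF [num v, Var 0]))))"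
proof -
  define G where "G = Imp (ap E [Var 0, Var 2, Var 1])
      (Imp (ap MemF [Var 2, Var 3]) (ap MemF [Var 1, Var 3]))"
  let ?n = "Leq (num n) (Var 1)"
    and ?\<sigma>u = "case_nat (num u) Var" and ?\<sigma>v = "case_nat (num v) (case_nat (num u) Var)"
    and ?\<sigma>w = "case_nat (num w) (case_nat (num v) (case_nat (num u) Var))"
  note bounds = assms(3-5)[THEN EA_Leq_num_mono, of "Var 1"]
  have "proves EA (Imp ?n (Imp (ClosedF E) (psubF ?\<sigma>u (BAll (Var 2) (BAll (Var 3) G)))))"
    by (rule taut_conseq2[OF BAllE[of _ Var "Var 1" "BAll (Var 2) (BAll (Var 3) G)" "num u"]
          bounds(2)]) (simp add: ClosedF_def G_def)
  moreover have "proves EA (Imp ?n (Imp (psubF ?\<sigma>u (BAll (Var 2) (BAll (Var 3) G)))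
      (psubF ?\<sigma>v (BAll (Var 3) G))))"
    by (rule taut_conseq2[OF BAllE[of _ ?\<sigma>u "Var 2" "BAll (Var 3) G" "num v"] bounds(3)]) simp
  moreover have "proves EA (Imp ?n (Imp (psubF ?\<sigma>v (BAll (Var 3) G)) (psubF ?\<sigma>w G)))"
    by (rule taut_conseq2[OF BAllE[of _ ?\<sigma>v "Var 3" G "num w"] bounds(1)]) simp
  ultimately have "proves EA (Imp ?n (Imp (ClosedF E) (psubF ?\<sigma>w G)))"
    by (rule taut_conseq3) simp
  then show ?thesis
    by (rule taut_conseq2[OF _ EA_Delta0_true[OF assms(1,2)]]) (simp add: G_def)
qed

lemma EA_StageF_transfer:
  assumes "Delta0 E" "evalF (env [w, u, v]) E" "w \<le> n" "u \<le> n" "v \<le> n"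
  shows "proves EA (Imp (Leq (num n) (Var 0)) (Imp (ap (StageF E F) [Var 0, num k, num v])
      (ap (StageF E F) [Var 0, num k, num u])))"
proof -
  define G where "G = BEx (Var 1) (Conj (ap MemF [Var 0, Var 1])
      (BEx (Var 2) (ap F [Var 0, num k, Var 1])))"
  let ?B = "\<lambda>x. Imp (ClosedF E) (Imp (ap MemF [num x, Var 0]) G)"
  have StageF_eq: "ap (StageF E F) [Var 0, num k, num x] =
      Conj (Leq (num x) (Var 0)) (BAll (Ex2 (Sc (Var 0))) (?B x))" for x
    unfolding StageF_def ClosedF_def G_def by (simp add: numeral_eq_Suc)
  have "proves EA (Imp (liftF 0 (Leq (num n) (Var 0))) (Imp (?B v) (?B u)))"
    by (rule taut_conseq1[OF EA_ClosedF_step[OF assms]]) simp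
  from BAll_mono[OF this, of "Ex2 (Sc (Var 0))"]
  show ?thesis unfolding StageF_eq
    by (rule taut_conseq2[OF _ EA_Leq_num_mono[OF assms(4), of "Var 0"]]) simp
qed

section \<open>The extensional Rosser formula\<close>

definition equiv_code :: "fm set \<Rightarrow> nat \<Rightarrow> nat \<Rightarrow> bool" where
  "equiv_code U a b \<longleftrightarrow> (\<exists>A B. a = codeF A \<and> b = codeF B \<and> proves U (Iff A B))"

definition self_app_code :: "nat \<Rightarrow> nat \<Rightarrow> nat \<Rightarrow> bool" where
  "self_app_code k c r \<longleftrightarrow> (\<exists>A B. k = codeF A \<and> c = codeF B \<and> r = codeF (app_code (app_code A A) B))"

definition asserts_code :: "fm set \<Rightarrow> nat \<Rightarrow> nat \<Rightarrow> bool" where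
  "asserts_code U k c \<longleftrightarrow>
     (\<exists>A B. k = codeF A \<and> c = codeF B \<and> proves U (Imp B (app_code (app_code A A) B)))"

definition denies_code :: "fm set \<Rightarrow> nat \<Rightarrow> nat \<Rightarrow> bool" where
  "denies_code U k c \<longleftrightarrow>
     (\<exists>A B. k = codeF A \<and> c = codeF B \<and> proves U (Imp B (Neg (app_code (app_code A A) B))))"

lemma ce2_equiv_code:
  assumes "ce_theory U"
  shows "ce2 (equiv_code U)"
proof -
  have "equiv_code U a b \<longleftrightarrow>
      Neg_code (Imp_code (Imp_code a b) (Neg_code (Imp_code b a))) \<in> theorem_codes U" for a b
    by (auto simp: equiv_code_def image_iff Imp_code_eq_codeF_iff Fls_code_eq_codeF_iff
      Iff_def Conj_def Neg_def)
  then show ?thesis unfolding ce2_def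
    by (simp only:) (intro sigma1_intros ce1_app[OF ce1_theorem_codes[OF assms]])
qed

lemma ce3_self_app_code: "ce3 self_app_code"
proof -
  have "self_app_code k c r \<longleftrightarrow> c \<in> range codeF \<and>
      (\<exists>n m q. n = codeT (num k) \<and> m = codeT (num c) \<and> inst_code k n q \<and> inst_code q m r)" for k c r
    unfolding self_app_code_def inst_code_def app_code_def by auto
  then show ?thesis unfolding ce3_def
    by (simp only:) (intro sigma1_intros ce1_app[OF ce1_range_codeF] ce2_app[OF ce2_num_code]
        ce3_app[OF ce3_inst_code])
qed

lemma ce2_asserts_code:
  assumes "ce_theory U"
  shows "ce2 (asserts_code U)"
proof -
  have "asserts_code U k c \<longleftrightarrow>
      (\<exists>r. self_app_code k c r \<and> Imp_code c r \<in> theorem_codes U)" for k c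
    by (auto simp: asserts_code_def self_app_code_def image_iff Imp_code_eq_codeF_iff)
  then show ?thesis unfolding ce2_def
    by (simp only:) (intro sigma1_intros ce1_app[OF ce1_theorem_codes[OF assms]]
        ce3_app[OF ce3_self_app_code])
qed

lemma ce2_denies_code:
  assumes "ce_theory U"
  shows "ce2 (denies_code U)"
proof -
  have "denies_code U k c \<longleftrightarrow>
      (\<exists>r. self_app_code k c r \<and> Imp_code c (Neg_code r) \<in> theorem_codes U)" for k c
    by (auto simp: denies_code_def self_app_code_def image_iff Imp_code_eq_codeF_iff
      Fls_code_eq_codeF_iff Neg_def)
  then show ?thesis unfolding ce2_def
    by (simp only:) (intro sigma1_intros ce1_app[OF ce1_theorem_codes[OF assms]]
        ce3_app[OF ce3_self_app_code])
qed

locale extensional_rosser =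
  fixes U :: "fm set" and E P N :: fm
  assumes EA_sub: "extends_EA U"
    and Delta0_E: "Delta0 E" and Delta0_P: "Delta0 P" and Delta0_N: "Delta0 N"
    and E_iff: "(\<exists>w. evalF (env [w, a, b]) E) \<longleftrightarrow> equiv_code U a b"
    and P_iff: "(\<exists>w. evalF (env [w, k, c]) P) \<longleftrightarrow> asserts_code U k c"
    and N_iff: "(\<exists>w. evalF (env [w, k, c]) N) \<longleftrightarrow> denies_code U k c"
begin

definition \<theta> :: fm where "\<theta> = Forall (RosserF E P N)"
definition \<rho> :: fm where "\<rho> = app_code \<theta> \<theta>"

abbreviation witness :: "fm \<Rightarrow> nat \<Rightarrow> fm \<Rightarrow> bool" where
  "witness F w A \<equiv> evalF (env [w, codeF \<theta>, codeF A]) F"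

abbreviation stage :: "fm \<Rightarrow> nat \<Rightarrow> fm \<Rightarrow> bool" where
  "stage F s A \<equiv> witness (StageF E F) s A"

abbreviation stage_formula :: "fm \<Rightarrow> fm \<Rightarrow> fm" where
  "stage_formula F A \<equiv> ap (StageF E F) [Var 0, num (codeF \<theta>), num (codeF A)]"

lemma Pi1_\<rho>: "Pi1 \<rho>"
  unfolding \<rho>_def \<theta>_def app_code_def inst_eq_psubF psubF.simps
  by (intro Pi1.intros Delta0_psubF Delta0_RosserF Delta0_E Delta0_P Delta0_N)

lemma closedF_\<rho>: "closedF 1 \<rho>"
proof -
  have "closedF 2 \<theta>" unfolding \<theta>_def using closedF_RosserF by (simp add: numeral_eq_Suc)
  then show ?thesis unfolding \<rho>_def app_code_def inst_eq_psubF
    by (rule closedF_psubF) (auto split: nat.splits)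
qed

lemma app_code_\<rho>:
  "app_code \<rho> A = Forall (Imp (stage_formula P A) (BEx (Var 0) (stage_formula N A)))"
proof -
  let ?\<sigma> = "up (case_nat (num (codeF \<theta>)) (case_nat (num (codeF A)) Var))"
  have "app_code \<rho> A = Forall (psubF ?\<sigma> (RosserF E P N))"
    by (simp add: \<rho>_def app_code_def \<theta>_def)
  also have "\<dots> = Forall (ap (RosserF E P N) [Var 0, num (codeF \<theta>), num (codeF A)])"
  proof (rule arg_cong[of _ _ Forall], rule psubF_cong_closed[OF closedF_RosserF])
    fix i :: nat assume "i < 3"
    then have "i = 0 \<or> i = 1 \<or> i = 2" by auto
    then show "?\<sigma> i = args [Var 0, num (codeF \<theta>), num (codeF A)] i"
      by auto
  qed
  finally show ?thesis by (simp add: RosserF_def)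
qed

lemma sentence_app_code: "sentence (app_code \<rho> A)"
  unfolding sentence_def app_code_\<rho> by (simp add: closedF_ap)

lemma proves_if_EA_proves: "proves EA A \<Longrightarrow> proves U A"
  by (rule proves_cut) (use EA_sub in \<open>simp_all add: extends_EA_def\<close>)

lemma P_witness_iff: "(\<exists>w. witness P w A) \<longleftrightarrow> proves U (Imp A (app_code \<rho> A))"
  unfolding P_iff asserts_code_def \<rho>_def by auto

lemma N_witness_iff:
  "(\<exists>w. witness N w A) \<longleftrightarrow> proves U (Imp A (Neg (app_code \<rho> A)))"
  unfolding N_iff denies_code_def \<rho>_def by auto

lemma equiv_if_found:
  assumes "(codeF A, c) \<in> (found_by E s)\<^sup>*"
  shows "\<exists>C. c = codeF C \<and> proves U (Iff A C)"
  using assms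
proof (induction rule: rtrancl_induct)
  case base
  have "proves U (Iff A A)" by (rule taut) simp
  then show ?case by blast
next
  case (step b c)
  then obtain B where B: "b = codeF B" "proves U (Iff A B)" by blast
  have "equiv_code U b c" using step.hyps(2) E_iff by (auto simp: found_by_def)
  then obtain C where C: "c = codeF C" "proves U (Iff B C)"
    using B(1) by (auto simp: equiv_code_def)
  have "proves U (Iff A C)" by (rule taut_conseq2[OF B(2) C(2)]) simp
  then show ?case using C(1) by blast
qed

lemma stageE:
  assumes "stage F s A"
  obtains C w where "proves U (Iff A C)" "stage F s C" "witness F w C"
proof -
  obtain c w where c: "codeF A \<le> s" "(codeF A, c) \<in> (found_by E s)\<^sup>*"
    and w: "w \<le> s" "evalF (env [w, codeF \<theta>, c]) F"
    using assms unfolding evalF_StageF by blast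
  obtain C where C: "c = codeF C" "proves U (Iff A C)" using equiv_if_found[OF c(2)] by blast
  have "evalF (env [s, codeF \<theta>, c]) (StageF E F)"
    by (rule evalF_StageF_self[OF w(2,1) found_by_rtrancl_le[OF c(2,1)]])
  then show ?thesis using that C w(2) by simp
qed

lemma EA_proves_app_code:
  assumes "\<forall>t < s. \<not> stage P t A" and "stage N s A"
  shows "proves EA (app_code \<rho> A)"
proof -
  let ?R = "Imp (stage_formula P A) (BEx (Var 0) (stage_formula N A))"
  have "proves EA ?R"
  proof (rule EA_cases_num)
    show "proves EA (BAll (num s) ?R)"
    proof (rule EA_BAll_numI)
      fix t assume "t \<le> s"
      then have "witness (RosserF E P N) t A"
        unfolding evalF_RosserF using assms by (metis le_eq_less_or_eq)
      from EA_Delta0_true[OF Delta0_RosserF[OF Delta0_E Delta0_P Delta0_N] this]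
      show "proves EA (inst ?R (num t))" by (simp add: RosserF_def)
    qed
    have "proves EA (inst (stage_formula N A) (num s))"
      using EA_Delta0_true[OF Delta0_StageF[OF Delta0_E Delta0_N] assms(2)] by simp
    then show "proves EA (Imp (Leq (num s) (Var 0)) ?R)"
      by (rule taut_conseq2[OF _ BExI[of _ "num s" "Var 0" "stage_formula N A"]]) simp
  qed
  then show ?thesis unfolding app_code_\<rho> by (rule gen)
qed

lemma EA_refutes_app_code:
  assumes "\<forall>t \<le> s. \<not> stage N t A" and "stage P s A"
  shows "proves EA (Neg (app_code \<rho> A))"
proof -
  let ?R = "Imp (stage_formula P A) (BEx (Var 0) (stage_formula N A))"
  have "\<not> witness (RosserF E P N) s A" unfolding evalF_RosserF using assms by blast
  from EA_Delta0_false[OF Delta0_RosserF[OF Delta0_E Delta0_P Delta0_N] this]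
  have "proves EA (Neg (inst ?R (num s)))" by (simp add: RosserF_def)
  then show ?thesis
    by (rule taut_conseq2[OF _ ForallE[of _ Var ?R "num s"]]) (simp add: app_code_\<rho>)
qed

lemma no_stage_unless_refuted:
  assumes "\<not> proves U (Neg A)"
  shows "\<not> stage P s A \<and> \<not> stage N s A"
  using assms
proof (induction s arbitrary: A rule: less_induct)
  case (less s)
  have not_N: "\<not> stage N s A" if "\<not> proves U (Neg A)" for A
  proof
    assume "stage N s A"
    then obtain C w where C: "proves U (Iff A C)" "stage N s C" "witness N w C"
      by (rule stageE)
    have consistent: "\<not> proves U (Neg C)" using proves_Neg_cong[OF C(1)] that by blast
    then have "proves U (app_code \<rho> C)"
      using less.IH C(2) by (blast intro: EA_proves_app_code proves_if_EA_proves)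
    moreover have "proves U (Imp C (Neg (app_code \<rho> C)))" using C(3) N_witness_iff by blast
    ultimately have "proves U (Neg C)" by (rule taut_conseq2) auto
    then show False using consistent by blast
  qed
  moreover have "\<not> stage P s A"
  proof
    assume "stage P s A"
    then obtain C w where C: "proves U (Iff A C)" "stage P s C" "witness P w C"
      by (rule stageE)
    have consistent: "\<not> proves U (Neg C)" using proves_Neg_cong[OF C(1)] less.prems by blast
    then have "\<forall>t \<le> s. \<not> stage N t C" using less.IH not_N by (metis le_eq_less_or_eq)
    then have "proves U (Neg (app_code \<rho> C))"
      using C(2) by (blast intro: EA_refutes_app_code proves_if_EA_proves)
    moreover have "proves U (Imp C (app_code \<rho> C))" using C(3) P_witness_iff by blast
    ultimately have "proves U (Neg C)" by (rule taut_conseq2) auto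
    then show False using consistent by blast
  qed
  ultimately show ?case using less.prems by blast
qed

lemma no_witness_unless_refuted:
  assumes "\<not> proves U (Neg A)"
  shows "\<not> witness P w A" and "\<not> witness N w A"
  using no_stage_unless_refuted[OF assms, of "max w (codeF A)"]
    evalF_StageF_self[of w _ "codeF A" _ "max w (codeF A)"]
  by auto

lemma independence:
  assumes "sentence A" and "consistent (insert A U)"
  shows "consistent (insert (app_code \<rho> A) (insert A U))"
    and "consistent (insert (Neg (app_code \<rho> A)) (insert A U))"
proof -
  note not_refuted = assms(2)[unfolded consistent_insert_iff[OF assms(1)]]
  have "\<not> proves U (Imp A (Neg (app_code \<rho> A)))" and not_proved: "\<not> proves U (Imp A (app_code \<rho> A))"
    using no_witness_unless_refuted[OF not_refuted] N_witness_iff P_witness_iff by blast+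
  then show "consistent (insert (app_code \<rho> A) (insert A U))"
    by (simp add: consistent_insert_iff sentence_app_code proves_insert_iff assms(1))
  have "\<not> proves U (Imp A (Neg (Neg (app_code \<rho> A))))"
    using not_proved
      taut_conseq1[of U "Imp A (Neg (Neg (app_code \<rho> A)))" "Imp A (app_code \<rho> A)"] by auto
  moreover have "sentence (Neg (app_code \<rho> A))" using sentence_app_code by (simp add: sentence_def)
  ultimately show "consistent (insert (Neg (app_code \<rho> A)) (insert A U))"
    by (simp add: consistent_insert_iff proves_insert_iff assms(1))
qed

lemma EA_stage_formula_cong:
  assumes "Delta0 F" and AB: "proves U (Iff A B)"
    and no_stage: "\<And>s. \<not> stage F s A" "\<And>s. \<not> stage F s B"
  shows "proves EA (Iff (stage_formula F A) (stage_formula F B))"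
proof -
  have BA: "proves U (Iff B A)" by (rule taut_conseq1[OF AB]) simp
  obtain v w where v: "evalF (env [v, codeF A, codeF B]) E"
    and w: "evalF (env [w, codeF B, codeF A]) E"
    using AB BA E_iff[of "codeF A" "codeF B"] E_iff[of "codeF B" "codeF A"]
    by (auto simp: equiv_code_def)
  define n where "n = Max {v, w, codeF A, codeF B}"
  have bounds: "v \<le> n" "w \<le> n" "codeF A \<le> n" "codeF B \<le> n" by (auto simp: n_def)
  show ?thesis
  proof (rule EA_cases_num)
    show "proves EA (BAll (num n) (Iff (stage_formula F A) (stage_formula F B)))"
    proof (rule EA_BAll_numI)
      fix s
      have "proves EA (Neg (inst (stage_formula F C) (num s)))" if "\<not> stage F s C" for C
        using EA_Delta0_false[OF Delta0_StageF[OF Delta0_E assms(1)] that] by simp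
      from taut_conseq2[OF no_stage[THEN this]]
      show "proves EA (inst (Iff (stage_formula F A) (stage_formula F B)) (num s))" by simp
    qed
    show "proves EA (Imp (Leq (num n) (Var 0)) (Iff (stage_formula F A) (stage_formula F B)))"
      by (rule taut_conseq2[OF EA_StageF_transfer[OF Delta0_E v bounds(1,3,4)]
            EA_StageF_transfer[OF Delta0_E w bounds(2,4,3)]]) auto
  qed
qed

lemma consistent_extensionality:
  assumes "\<not> proves U (Neg A)" and AB: "proves U (Iff A B)"
  shows "proves EA (Iff (app_code \<rho> A) (app_code \<rho> B))"
proof -
  have "\<not> proves U (Neg B)" using proves_Neg_cong[OF AB] assms(1) by blast
  note no_stages = no_stage_unless_refuted[OF assms(1)] no_stage_unless_refuted[OF this]
  have "proves EA (Iff (stage_formula P A) (stage_formula P B))"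
    using EA_stage_formula_cong[OF Delta0_P AB] no_stages by blast
  moreover have
    "proves EA (Iff (BEx (Var 0) (stage_formula N A)) (BEx (Var 0) (stage_formula N B)))"
    using BEx_cong[OF EA_stage_formula_cong[OF Delta0_N AB]] no_stages by blast
  ultimately show ?thesis
    unfolding app_code_\<rho> by (intro Forall_cong) (rule taut_conseq2, assumption+, simp)
qed

end

theorem mainTheorem4:
  fixes U :: "fm set"
  assumes "\<forall>A\<in>U. sentence A"
    and "ce_theory U"
    and "consistent U"
    and "extends_EA U"
  shows "\<exists>\<rho>. Pi1 \<rho> \<and> closedF 1 \<rho> \<and>
    (\<forall>\<phi>. sentence \<phi> \<and> consistent (insert \<phi> U) \<longrightarrow>
        consistent (insert (app_code \<rho> \<phi>) (insert \<phi> U)) \<and>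
        consistent (insert (Neg (app_code \<rho> \<phi>)) (insert \<phi> U))) \<and>
    (\<forall>\<phi> \<psi>. sentence \<phi> \<and> sentence \<psi> \<and> consistent (insert \<phi> U) \<and> proves U (Iff \<phi> \<psi>) \<longrightarrow>
        proves EA (Iff (app_code \<rho> \<phi>) (app_code \<rho> \<psi>)))"
proof -
  obtain E where E: "Delta0 E" "\<And>a b. (\<exists>w. evalF (env [w, a, b]) E) \<longleftrightarrow> equiv_code U a b"
    using ce2_Delta0_formula[OF ce2_equiv_code[OF assms(2)]] by blast
  obtain P where P: "Delta0 P" "\<And>k c. (\<exists>w. evalF (env [w, k, c]) P) \<longleftrightarrow> asserts_code U k c"
    using ce2_Delta0_formula[OF ce2_asserts_code[OF assms(2)]] by blast
  obtain N where N: "Delta0 N" "\<And>k c. (\<exists>w. evalF (env [w, k, c]) N) \<longleftrightarrow> denies_code U k c"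
    using ce2_Delta0_formula[OF ce2_denies_code[OF assms(2)]] by blast
  interpret extensional_rosser U E P N
    using assms(4) E P N by unfold_locales
  show ?thesis
    using Pi1_\<rho> closedF_\<rho> independence consistent_extensionality consistent_insert_iff
    by (intro exI[of _ \<rho>]) blast
qed

end
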